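(* For every $1\leq r\leq\infty$ and $k\geq8$ there exist $\mathscr{F}\in\mathrm{RT}^r_{k+1}(\mathbb{S}^1)$ and $\mathscr{G}\in\mathrm{RT}^r_k(\mathbb{S}^1)$ such that $\mathscr{F}$ is minimal but $\mathscr{F}^{-1}$ is not minimal, and neither $\mathscr{G}$ nor $\mathscr{G}^{-1}$ is minimal.
   Context: $\mathrm{IFS}^r_k(\mathbb{S}^1)$ is the set of families of $k$ orientation-preserving $C^r$ circle diffeomorphisms, identified up to reordering, with metric $\bar{\mathrm{d}}_r(\mathscr{F},\mathscr{G})=\min_{\sigma\in S_k}\sum_i\mathrm{d}_r(f_i,g_{\sigma(i)})$. A family is minimal if the orbit $\{h(x):h\in\langle\mathscr{F}\rangle^+\}$ of every point is dense ($\langle\mathscr{F}\rangle^+$ = semigroup of finite compositions), transitive if the orbit $\bigcup_{h\in\langle\mathscr{F}\rangle^+}h(U)$ of every nonempty open set $U$ is dense. $\mathrm{RT}^r_k(\mathbb{S}^1)$ is the set of $\mathscr{F}\in\mathrm{IFS}^r_k(\mathbb{S}^1)$ having a $\bar{\mathrm{d}}_r$-neighborhood consisting of transitive families. $\mathscr{F}^{-1}=\{f^{-1}:f\in\mathscr{F}\}$. *)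

theory Defs
  imports "HOL-Analysis.Analysis" "HOL-Library.Extended_Nat" "HOL-Combinatorics.Permutations"
begin

(* Circle S^1 = R/Z.  An orientation-preserving C^r diffeomorphism of S^1 is
   represented by a lift F : R -> R (F(x+1) = F x + 1, C^r, F' > 0);
   lifts differing by an integer represent the same diffeomorphism. *)

definition Cr :: "enat \<Rightarrow> (real \<Rightarrow> real) \<Rightarrow> bool" where
  "Cr r F \<longleftrightarrow> (\<forall>j::nat.
      (enat j \<le> r \<longrightarrow> continuous_on UNIV ((deriv ^^ j) F)) \<and>
      (enat j < r \<longrightarrow> (\<forall>x. (deriv ^^ j) F differentiable (at x))))"

definition diff_lift :: "enat \<Rightarrow> (real \<Rightarrow> real) \<Rightarrow> bool" where
  "diff_lift r F \<longleftrightarrow> Cr r F \<and> (\<forall>x. F (x + 1) = F x + 1) \<and> (\<forall>x. deriv F x > 0)"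

definition circ_dist :: "real \<Rightarrow> real \<Rightarrow> real" where
  "circ_dist x y = (INF n::int. \<bar>x - y - of_int n\<bar>)"

definition dist_j :: "nat \<Rightarrow> (real \<Rightarrow> real) \<Rightarrow> (real \<Rightarrow> real) \<Rightarrow> real" where
  "dist_j j F G = (if j = 0 then (SUP x. circ_dist (F x) (G x))
                   else (SUP x. \<bar>(deriv ^^ j) F x - (deriv ^^ j) G x\<bar>))"

definition d_r :: "enat \<Rightarrow> (real \<Rightarrow> real) \<Rightarrow> (real \<Rightarrow> real) \<Rightarrow> real" where
  "d_r r F G = (if r = \<infinity> then (\<Sum>j. (1/2) ^ j * min 1 (dist_j j F G))
                else (\<Sum>j\<in>{0..the_enat r}. dist_j j F G))"

(* IFS^r_k: families of k diffeomorphisms (lists; order irrelevant via dbar) *)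
definition IFS :: "enat \<Rightarrow> nat \<Rightarrow> (real \<Rightarrow> real) list \<Rightarrow> bool" where
  "IFS r k Fs \<longleftrightarrow> length Fs = k \<and> (\<forall>F\<in>set Fs. diff_lift r F)"

definition dbar :: "enat \<Rightarrow> (real \<Rightarrow> real) list \<Rightarrow> (real \<Rightarrow> real) list \<Rightarrow> real" where
  "dbar r Fs Gs = Min {(\<Sum>i<length Fs. d_r r (Fs ! i) (Gs ! (\<sigma> i))) | \<sigma>. \<sigma> permutes {..<length Fs}}"

definition semigrp :: "(real \<Rightarrow> real) list \<Rightarrow> (real \<Rightarrow> real) set" where
  "semigrp Fs = {foldr (\<circ>) ws id | ws. ws \<noteq> [] \<and> set ws \<subseteq> set Fs}"

(* orbit of the circle point x+Z, as a Z-invariant subset of R *)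
definition orbit_pt :: "(real \<Rightarrow> real) list \<Rightarrow> real \<Rightarrow> real set" where
  "orbit_pt Fs x = {h x + of_int n | h n. h \<in> semigrp Fs}"

definition ifs_minimal :: "(real \<Rightarrow> real) list \<Rightarrow> bool" where
  "ifs_minimal Fs \<longleftrightarrow> (\<forall>x. closure (orbit_pt Fs x) = UNIV)"

(* open sets of S^1 are exactly images of open sets of R *)
definition ifs_transitive :: "(real \<Rightarrow> real) list \<Rightarrow> bool" where
  "ifs_transitive Fs \<longleftrightarrow> (\<forall>U. open U \<and> U \<noteq> {} \<longrightarrow>
      closure {h u + of_int n | h u n. h \<in> semigrp Fs \<and> u \<in> U} = UNIV)"

definition RT :: "enat \<Rightarrow> nat \<Rightarrow> (real \<Rightarrow> real) list \<Rightarrow> bool" where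
  "RT r k Fs \<longleftrightarrow> IFS r k Fs \<and>
     (\<exists>\<epsilon>>0. \<forall>Gs. IFS r k Gs \<and> dbar r Fs Gs < \<epsilon> \<longrightarrow> ifs_transitive Gs)"

definition inv_fam :: "(real \<Rightarrow> real) list \<Rightarrow> (real \<Rightarrow> real) list" where
  "inv_fam Fs = map inv Fs"

end

theory Submission
  imports Defs "HOL-Computational_Algebra.Polynomial"
begin

text \<open>Robust transitivity comes from a blender: finitely many contractions \<open>f\<close> of an interval \<open>L\<close> into
  itself whose images of a smaller interval \<open>J\<close> cover \<open>J\<close>. Every orbit entering \<open>L\<close> is then dense in
  \<open>J\<close>, so it is dense in the circle as soon as every open set is reached from \<open>J\<close>. The latter is
  obtained by letting the inverses of some generators expand the open set until it leaves the arcs on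
  which they expand. All these conditions are stable under \<open>C\<^sup>1\<close>-small perturbations.

  For \<open>\<G>\<close> all maps share a fixed point, which is attracting for one map and repelling for the others;
  hence neither \<open>\<G>\<close> nor its inverse is minimal. For \<open>\<F>\<close> the inverses preserve a Cantor set contained in
  three arcs: an exchange of one arc with the other two, two rotations, and maps that pull the
  Cantor set into itself while stretching one of its gaps. The blender lies in such a gap and every
  point of the circle enters it, so \<open>\<F>\<close> is minimal although its inverse is not.\<close>

subsection \<open>Smooth gluing of affine maps\<close>

text \<open>Invariance of the Cantor set under the inverses only traps forward orbits that start in
  its complement, and this complement is dense; this is why \<F> can still be minimal. The
  invariance is used for the exact family alone. What is said about perturbations rests on finitely
  many affine pieces over intervals, and all inequalities there leave room for an error of 1/2000.
  The family \<F> has eight distinct maps: five contractions, the exchange and two rotations. Five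
  contractions are taken because their slope is 1/4: four images of \<open>J\<close> would have
  total length at most that of \<open>J\<close>, leaving no overlap to survive a perturbation. The
  Cantor set is periodic under translation by 1/3, so the rotations preserve it and reduce all
  estimates to one arc; the inverse of the exchange expands this arc. The maps are built smooth, so
  that the construction does not depend on r. Of the distance only the terms of order 0 and 1 are
  exploited, and 1 \<le> r makes them available.\<close>

fun Cn :: "nat \<Rightarrow> (real \<Rightarrow> real) \<Rightarrow> bool" where
  "Cn 0 f \<longleftrightarrow> True"
| "Cn (Suc n) f \<longleftrightarrow> (\<exists>f'. (\<forall>x. (f has_real_derivative f' x) (at x)) \<and> Cn n f')"

lemma Cn_mono: "Cn (Suc n) f \<Longrightarrow> Cn n f"
  by (induction n arbitrary: f) auto

lemma Cn_const: "Cn n (\<lambda>x. c)"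
proof (induction n arbitrary: c)
  case (Suc n)
  have "\<forall>x. ((\<lambda>x::real. c) has_real_derivative 0) (at x)" by auto
  then show ?case using Suc[of 0] by (auto intro!: exI[of _ "\<lambda>_. 0"])
qed simp

lemma Cn_id: "Cn n (\<lambda>x. x)"
proof (cases n)
  case (Suc m)
  have "\<forall>x::real. ((\<lambda>x. x) has_real_derivative 1) (at x)" by auto
  then show ?thesis using Cn_const[of m 1] Suc by (auto intro!: exI[of _ "\<lambda>_. 1"])
qed simp

lemma Cn_add: "Cn n f \<Longrightarrow> Cn n g \<Longrightarrow> Cn n (\<lambda>x. f x + g x)"
proof (induction n arbitrary: f g)
  case (Suc n)
  then obtain f' g' where
    "\<forall>x. (f has_real_derivative f' x) (at x)" "Cn n f'"
    "\<forall>x. (g has_real_derivative g' x) (at x)" "Cn n g'" by auto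
  then show ?case using Suc.IH[of f' g']
    by (auto intro!: exI[of _ "\<lambda>x. f' x + g' x"] derivative_eq_intros)
qed simp

lemma Cn_mult: "Cn n f \<Longrightarrow> Cn n g \<Longrightarrow> Cn n (\<lambda>x. f x * g x)"
proof (induction n arbitrary: f g)
  case (Suc n)
  from Suc.prems obtain f' g' where
    D: "\<forall>x. (f has_real_derivative f' x) (at x)" "Cn n f'"
    "\<forall>x. (g has_real_derivative g' x) (at x)" "Cn n g'" by auto
  have "Cn n (\<lambda>x. f' x * g x + g' x * f x)"
    using D Suc.prems[THEN Cn_mono] by (intro Cn_add Suc.IH)
  moreover have "((\<lambda>x. f x * g x) has_real_derivative f' x * g x + g' x * f x) (at x)" for x
    using D by (auto intro!: derivative_eq_intros)
  ultimately show ?case by (auto intro!: exI[of _ "\<lambda>x. f' x * g x + g' x * f x"])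
qed simp

lemma Cn_diff: "Cn n f \<Longrightarrow> Cn n g \<Longrightarrow> Cn n (\<lambda>x. f x - g x)"
  using Cn_add[of n f "\<lambda>x. (-1) * g x"] Cn_mult[OF Cn_const[of n "-1"], of g] by simp

lemma Cn_affine_comp: "Cn n f \<Longrightarrow> Cn n (\<lambda>x. f (a * x + b))"
proof (induction n arbitrary: f)
  case (Suc n)
  from Suc.prems obtain f' where
    D: "\<forall>x. (f has_real_derivative f' x) (at x)" "Cn n f'" by auto
  have "Cn n (\<lambda>x. f' (a * x + b) * a)"
    using Suc.IH[OF D(2)] Cn_const by (rule Cn_mult)
  moreover have "((\<lambda>x. f (a * x + b)) has_real_derivative f' (a * x + b) * a) (at x)" for x
    by (rule DERIV_chain'[where g = f]) (use D in \<open>auto intro!: derivative_eq_intros\<close>)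
  ultimately show ?case by (auto intro!: exI[of _ "\<lambda>x. f' (a * x + b) * a"])
qed simp

lemma Cn_inverse: "Cn n f \<Longrightarrow> (\<And>x. f x \<noteq> 0) \<Longrightarrow> Cn n (\<lambda>x. inverse (f x))"
proof (induction n arbitrary: f)
  case (Suc n)
  from Suc.prems obtain f' where
    D: "\<forall>x. (f has_real_derivative f' x) (at x)" "Cn n f'" by auto
  have I: "Cn n (\<lambda>x. inverse (f x))" using Suc Cn_mono by blast
  have "Cn n (\<lambda>x. (-1) * (f' x * (inverse (f x) * inverse (f x))))"
    by (intro Cn_mult Cn_const I D)
  moreover have "((\<lambda>x. inverse (f x)) has_real_derivative
      (-1) * (f' x * (inverse (f x) * inverse (f x)))) (at x)" for x
    using D Suc.prems(2) by (auto intro!: derivative_eq_intros simp: field_simps)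
  ultimately show ?case
    by (auto intro!: exI[of _ "\<lambda>x. (-1) * (f' x * (inverse (f x) * inverse (f x)))"])
qed simp

text \<open>\<open>Cn\<close> asks for n derivatives without continuity of the last one. Requiring
  it for every n supplies the continuity and gives \<open>Cr r\<close> for all r at once,
  \<infinity> included.\<close>

definition smooth :: "(real \<Rightarrow> real) \<Rightarrow> bool" where
  "smooth f \<longleftrightarrow> (\<forall>n. Cn n f)"

lemma smooth_DERIV: "smooth f \<Longrightarrow> (f has_real_derivative deriv f x) (at x)"
proof -
  assume "smooth f"
  then have "Cn (Suc 0) f" unfolding smooth_def by blast
  then obtain f' where "\<forall>x. (f has_real_derivative f' x) (at x)" by auto
  then show ?thesis by (metis DERIV_imp_deriv)
qed

lemma smooth_deriv: "smooth f \<Longrightarrow> smooth (deriv f)"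
  unfolding smooth_def
proof
  fix n assume "\<forall>n. Cn n f"
  then have "Cn (Suc n) f" by blast
  then obtain f' where f': "\<forall>x. (f has_real_derivative f' x) (at x)" "Cn n f'" by auto
  then have "deriv f = f'" by (auto intro!: ext DERIV_imp_deriv)
  then show "Cn n (deriv f)" using f' by simp
qed

lemma smooth_imp_Cr: assumes "smooth f" shows "Cr r f"
proof -
  have *: "smooth ((deriv ^^ j) f)" for j
    by (induction j) (auto simp: assms smooth_deriv)
  have "(deriv ^^ j) f differentiable (at x)" for j x
    using smooth_DERIV[OF *] real_differentiable_def by blast
  then show ?thesis
    unfolding Cr_def by (auto intro!: differentiable_imp_continuous_on
        simp: differentiable_on_def intro: differentiable_at_withinI)
qed

section \<open>A smooth cut-off from exp(-1/x)\<close>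

lemma poly_times_exp_neg_tendsto_0:
  fixes p :: "real poly"
  shows "((\<lambda>y. poly p y * exp (- y)) \<longlongrightarrow> 0) at_top"
proof -
  have "((\<lambda>y. \<Sum>i\<le>degree p. coeff p i * (y ^ i / exp y)) \<longlongrightarrow> (\<Sum>i\<le>degree p. coeff p i * 0)) at_top"
    by (intro tendsto_intros tendsto_power_div_exp_0)
  moreover have "(\<Sum>i\<le>degree p. coeff p i * (y ^ i / exp y)) = poly p y * exp (- y)" for y
    by (simp add: poly_altdef sum_distrib_right exp_minus divide_inverse mult.assoc)
  ultimately show ?thesis by simp
qed

text \<open>The classical flat function exp(-1/x), with a polynomial in 1/x as a factor so that the
  class is closed under differentiation. Smoothness is then an induction with p arbitrary.\<close>

definition flat :: "real poly \<Rightarrow> real \<Rightarrow> real" where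
  "flat p x = (if x \<le> 0 then 0 else poly p (inverse x) * exp (- inverse x))"

lemma flat_DERIV:
  "(flat p has_real_derivative flat ([:0, 0, 1:] * (p - pderiv p)) x) (at x)"
proof -
  let ?q = "[:0, 0, 1:] * (p - pderiv p)"
  consider "x < 0" | "x = 0" | "x > 0" by linarith
  then show ?thesis
  proof cases
    case 1
    have "((\<lambda>_. 0) has_real_derivative 0) (at x)" by simp
    then have "(flat p has_real_derivative 0) (at x)"
      by (rule has_field_derivative_transform_within_open[where S = "{..<0}"])
        (use 1 in \<open>auto simp: flat_def\<close>)
    then show ?thesis using 1 by (simp add: flat_def)
  next
    case 3
    have "((\<lambda>x. poly p (inverse x) * exp (- inverse x)) has_real_derivative
        poly ?q (inverse x) * exp (- inverse x)) (at x)"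
      using 3 by (auto intro!: derivative_eq_intros simp: field_simps power2_eq_square)
    then have "(flat p has_real_derivative poly ?q (inverse x) * exp (- inverse x)) (at x)"
      by (rule has_field_derivative_transform_within_open[where S = "{0<..}"])
        (use 3 in \<open>auto simp: flat_def\<close>)
    then show ?thesis using 3 by (simp add: flat_def)
  next
    case 2
    \<comment> \<open>The factor \<open>[:0,1:]\<close> absorbs the division by h in the difference
      quotient at 0; y stands for 1/h.\<close>
    have "((\<lambda>y. poly ([:0,1:] * p) y * exp (- y)) \<longlongrightarrow> 0) at_top"
      by (rule poly_times_exp_neg_tendsto_0)
    then have "((\<lambda>h. poly ([:0,1:] * p) (inverse h) * exp (- inverse h)) \<longlongrightarrow> 0) (at_right 0)"
      by (rule filterlim_compose) (rule filterlim_inverse_at_top_right)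
    then have "((\<lambda>h. (flat p (0 + h) - flat p 0) / h) \<longlongrightarrow> 0) (at_right 0)"
      by (rule Lim_transform_eventually)
        (auto simp: eventually_at_right_field flat_def field_simps intro!: exI[of _ 1])
    moreover have "((\<lambda>h. (flat p (0 + h) - flat p 0) / h) \<longlongrightarrow> 0) (at_left 0)"
      by (rule Lim_transform_eventually[OF tendsto_const])
        (auto simp: eventually_at_left_field flat_def intro!: exI[of _ "-1"])
    ultimately have "(flat p has_real_derivative 0) (at 0)"
      unfolding DERIV_def using filterlim_split_at by fastforce
    then show ?thesis using 2 by (simp add: flat_def)
  qed
qed

lemma Cn_flat: "Cn n (flat p)"
proof (induction n arbitrary: p)
  case (Suc n)
  show ?case using flat_DERIV[of p] Suc by auto
qed simp

definition step :: "real \<Rightarrow> real" where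
  "step x = flat 1 x * inverse (flat 1 x + flat 1 (1 - x))"

lemma flat1_nonneg: "0 \<le> flat 1 x" and flat1_pos: "0 < x \<Longrightarrow> 0 < flat 1 x"
  by (auto simp: flat_def)

lemma flat1_sum_pos: "0 < flat 1 x + flat 1 (1 - x)"
  using flat1_nonneg[of x] flat1_nonneg[of "1 - x"] flat1_pos[of x] flat1_pos[of "1 - x"]
  by (cases "x > 0") auto

lemma Cn_step: "Cn n step"
proof -
  have "Cn n (\<lambda>x. flat 1 (1 - x))"
    using Cn_affine_comp[OF Cn_flat, of n 1 "-1" 1] by simp
  then have "Cn n (\<lambda>x. flat 1 x * inverse (flat 1 x + flat 1 (1 - x)))"
    by (intro Cn_mult Cn_inverse Cn_add Cn_flat) (auto simp: flat1_sum_pos order_less_imp_not_eq2)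
  then show ?thesis by (simp add: step_def[abs_def])
qed

lemma step_0: "x \<le> 0 \<Longrightarrow> step x = 0"
  by (simp add: step_def flat_def)

lemma step_1: "1 \<le> x \<Longrightarrow> step x = 1"
  using flat1_pos[of x] by (simp add: step_def flat_def)

lemma step_bounds: "0 \<le> step x" "step x \<le> 1"
  using flat1_nonneg[of x] flat1_nonneg[of "1 - x"] flat1_sum_pos[of x]
  by (auto simp: step_def field_simps)

lemma step_DERIV: "\<exists>D\<ge>0. (step has_real_derivative D) (at x)"
proof -
  \<comment> \<open>For p = 1 the polynomial of the derivative is the square of the variable, so
    \<open>?e'\<close> is nonnegative; the sign of the derivative of \<open>step\<close>
    follows.\<close>
  let ?e' = "flat ([:0, 0, 1:] * (1 - pderiv 1))"
  have e': "0 \<le> flat [:0, 0, 1:] y" for y by (simp add: flat_def)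
  have D: "(flat 1 has_real_derivative ?e' x) (at x)" by (rule flat_DERIV)
  have D1: "((\<lambda>x. flat 1 (1 - x)) has_real_derivative ?e' (1 - x) * (-1)) (at x)"
    by (rule DERIV_chain'[where g = "flat 1", OF _ flat_DERIV]) (auto intro!: derivative_eq_intros)
  let ?s = "flat 1 x + flat 1 (1 - x)"
  have "((\<lambda>x. flat 1 x * inverse (flat 1 x + flat 1 (1 - x))) has_real_derivative
      (?e' x * flat 1 (1 - x) + flat 1 x * ?e' (1 - x)) / ?s\<^sup>2) (at x)"
    using flat1_sum_pos[of x]
    by (auto intro!: derivative_eq_intros D D1 simp: field_simps power2_eq_square)
  then show ?thesis
    unfolding step_def[abs_def, symmetric]
    by (intro exI conjI) (auto intro!: divide_nonneg_nonneg add_nonneg_nonneg mult_nonneg_nonneg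
        flat1_nonneg e')
qed

definition smooth_incr :: "(real \<Rightarrow> real) \<Rightarrow> bool" where
  "smooth_incr f \<longleftrightarrow> smooth f \<and> (\<forall>x. deriv f x > 0)"

lemma smooth_incr_affine: "m > 0 \<Longrightarrow> smooth_incr (\<lambda>x. m * x + c)"
  unfolding smooth_incr_def smooth_def
proof (intro conjI allI)
  fix n show "Cn n (\<lambda>x. m * x + c)" by (intro Cn_add Cn_mult Cn_const Cn_id)
next
  fix x assume "0 < m"
  moreover have "deriv (\<lambda>x. m * x + c) x = m"
    by (auto intro!: DERIV_imp_deriv derivative_eq_intros)
  ultimately show "0 < deriv (\<lambda>x. m * x + c) x" by simp
qed

text \<open>The inequality between \<open>f\<close> and \<open>g\<close> makes the term containing the derivative of the
  cut-off nonnegative.\<close>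

lemma smooth_incr_glue:
  assumes f: "smooth_incr f" and g: "smooth_incr g" and ab: "a < b"
    and le: "\<And>x. a \<le> x \<Longrightarrow> x \<le> b \<Longrightarrow> f x \<le> g x"
  shows "\<exists>h. smooth_incr h \<and> (\<forall>x\<le>a. h x = f x) \<and> (\<forall>x\<ge>b. h x = g x)"
proof -
  define k where "k = inverse (b - a)"
  have k: "k > 0" using ab by (simp add: k_def)
  define s where "s = (\<lambda>x. step (k * x + (- k * a)))"
  define h where "h = (\<lambda>x. f x + s x * (g x - f x))"
  have s0: "s x = 0" if "x \<le> a" for x
    unfolding s_def by (rule step_0) (use that k in \<open>simp add: mult_left_mono\<close>)
  have s1: "s x = 1" if "x \<ge> b" for x
  proof -
    have "k * (b - a) \<le> k * (x - a)" using that k by (intro mult_left_mono) auto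
    moreover have "k * (b - a) = 1" using ab by (simp add: k_def)
    ultimately have "1 \<le> k * x + (- k * a)" by (simp add: right_diff_distrib)
    then show ?thesis unfolding s_def by (rule step_1)
  qed
  have "Cn n h" for n
    unfolding h_def s_def using f g
    by (intro Cn_add Cn_mult Cn_diff Cn_affine_comp Cn_step)
      (auto simp: smooth_incr_def smooth_def)
  then have "smooth h" by (simp add: smooth_def)
  moreover have "deriv h x > 0" for x
  proof -
    obtain D where D: "D \<ge> 0" "(step has_real_derivative D) (at (k * x + (- k * a)))"
      using step_DERIV by blast
    have Ds: "(s has_real_derivative D * k) (at x)"
      unfolding s_def
      by (rule DERIV_chain'[where g = step]) (use D(2) in \<open>auto intro!: derivative_eq_intros\<close>)
    have Df: "(f has_real_derivative deriv f x) (at x)" and Dg: "(g has_real_derivative deriv g x) (at x)"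
      using f g smooth_DERIV by (auto simp: smooth_incr_def)
    have pos: "deriv f x > 0" "deriv g x > 0" using f g by (auto simp: smooth_incr_def)
    have "(h has_real_derivative
        (1 - s x) * deriv f x + s x * deriv g x + D * k * (g x - f x)) (at x)"
      unfolding h_def
      by (rule DERIV_cong[OF DERIV_add[OF Df DERIV_mult[OF Ds DERIV_diff[OF Dg Df]]]])
        (simp add: algebra_simps)
    then have eq: "deriv h x = (1 - s x) * deriv f x + s x * deriv g x + D * k * (g x - f x)"
      by (rule DERIV_imp_deriv)
    have sb: "0 \<le> s x" "s x \<le> 1" by (auto simp: s_def step_bounds)
    have "min (deriv f x) (deriv g x) \<le> (1 - s x) * deriv f x + s x * deriv g x"
    proof -
      have "(1 - s x) * min (deriv f x) (deriv g x) + s x * min (deriv f x) (deriv g x)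
          \<le> (1 - s x) * deriv f x + s x * deriv g x"
        using sb by (intro add_mono mult_left_mono) auto
      then show ?thesis by (simp add: algebra_simps)
    qed
    moreover have "0 \<le> D * k * (g x - f x)"
    proof (cases "a \<le> x \<and> x \<le> b")
      case True then show ?thesis using D k le by simp
    next
      case False
      \<comment> \<open>Outside [a, b] the sign of g - f is unknown, but there \<open>s\<close> is
        locally constant and its derivative vanishes.\<close>
      have "D * k = 0"
      proof -
        have S: "open ({..<a} \<union> {b<..})" "x \<in> {..<a} \<union> {b<..}" using False by auto
        have loc: "(s has_real_derivative 0) (at x)" 
        proof (cases "x < a")
          case True
          have "((\<lambda>_. 0) has_real_derivative 0) (at x)" by simp
          then show ?thesis
            by (rule has_field_derivative_transform_within_open[where S = "{..<a}"])
              (use True s0 in auto)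
        next
          case nF: False
          have "((\<lambda>_. 1) has_real_derivative 0) (at x)" by simp
          then show ?thesis
            by (rule has_field_derivative_transform_within_open[where S = "{b<..}"])
              (use nF False s1 in auto)
        qed
        then show ?thesis using Ds DERIV_unique by blast
      qed
      then show ?thesis by (simp only: mult_zero_left order_refl)
    qed
    ultimately show ?thesis using eq pos by linarith
  qed
  ultimately have "smooth_incr h" by (simp add: smooth_incr_def)
  moreover have "\<forall>x\<le>a. h x = f x" "\<forall>x\<ge>b. h x = g x" by (auto simp: h_def s0 s1)
  ultimately show ?thesis by blast
qed

text \<open>Derivatives agree with those of the local model on the same open set, so the induction
  passes to them. The periodic extension below is given by one smooth formula only locally.\<close>

lemma Cn_local:
  assumes "\<And>x. \<exists>U g. open U \<and> x \<in> U \<and> Cn n g \<and> (\<forall>y\<in>U. f y = g y)"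
  shows "Cn n f"
  using assms
proof (induction n arbitrary: f)
  case (Suc n)
  have ex: "\<exists>U g g'. open U \<and> x \<in> U \<and> Cn n g' \<and> (\<forall>y\<in>U. f y = g y) \<and>
      (\<forall>y. (g has_real_derivative g' y) (at y))" for x
  proof -
    obtain U g where U: "open U" "x \<in> U" "Cn (Suc n) g" "\<forall>y\<in>U. f y = g y"
      using Suc.prems[of x] by blast
    then obtain g' where "(\<forall>y. (g has_real_derivative g' y) (at y))" "Cn n g'" by auto
    with U show ?thesis by blast
  qed
  have D: "(f has_real_derivative g' y) (at y)"
    if "open U" "y \<in> U" "\<forall>y\<in>U. f y = g y" "\<forall>y. (g has_real_derivative g' y) (at y)" for U g g' y
    by (rule has_field_derivative_transform_within_open[where S = U and f = g]) (use that in auto)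
  have "(f has_real_derivative deriv f x) (at x)" for x
    using ex[of x] D by (metis DERIV_imp_deriv)
  moreover have "Cn n (deriv f)"
  proof (rule Suc.IH)
    fix x
    obtain U g g' where U: "open U" "x \<in> U" "Cn n g'" "\<forall>y\<in>U. f y = g y"
      "\<forall>y. (g has_real_derivative g' y) (at y)" using ex[of x] by blast
    have "\<forall>y\<in>U. deriv f y = g' y" using D[OF U(1) _ U(4,5)] DERIV_imp_deriv by blast
    then show "\<exists>U g. open U \<and> x \<in> U \<and> Cn n g \<and> (\<forall>y\<in>U. deriv f y = g y)" using U by blast
  qed
  ultimately show ?case by auto
qed simp

text \<open>Since the periodicity relation holds on a whole window around \<open>x0\<close>,
  consecutive translates of P agree near the seam and no smoothness is lost there.\<close>

lemma diff_lift_periodic_extension: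
  assumes P: "smooth_incr P" and e: "e > 0"
    and per: "\<And>x. x0 - e < x \<Longrightarrow> x < x0 + e \<Longrightarrow> P (x + 1) = P x + 1"
  shows "\<exists>F. (\<forall>r. diff_lift r F) \<and> (\<forall>x. x0 \<le> x \<longrightarrow> x \<le> x0 + 1 \<longrightarrow> F x = P x)"
proof -
  define F where "F = (\<lambda>x. P (x - of_int \<lfloor>x - x0\<rfloor>) + of_int \<lfloor>x - x0\<rfloor>)"
  \<comment> \<open>The cap 1 keeps a point to the left of the seam within the preceding period, so
    that its floor is n - 1.\<close>
  define e' where "e' = min e 1"
  have loc: "F y = P (y - of_int n) + of_int n"
    if "of_int n - e' < y - x0" "y - x0 < of_int n + 1" for n y
  proof (cases "of_int n \<le> y - x0")
    case True
    then have "\<lfloor>y - x0\<rfloor> = n" using that by linarith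
    then show ?thesis by (simp add: F_def)
  next
    case False
    then have fl: "\<lfloor>y - x0\<rfloor> = n - 1" using that by (simp add: e'_def floor_eq_iff)
    have "P (y - of_int n + 1) = P (y - of_int n) + 1"
      using that False by (intro per) (auto simp: e'_def)
    then show ?thesis by (simp add: F_def fl algebra_simps)
  qed
  have sh: "Cn m (\<lambda>y. P (y - of_int n) + of_int n)" for m and n :: int
    using Cn_add[OF Cn_affine_comp[of m P 1 "- of_int n"] Cn_const] P
    by (simp add: smooth_incr_def smooth_def)
  have nb: "\<exists>n::int. open {x0 + of_int n - e' <..< x0 + of_int n + 1} \<and>
      x \<in> {x0 + of_int n - e' <..< x0 + of_int n + 1} \<and>
      (\<forall>y\<in>{x0 + of_int n - e' <..< x0 + of_int n + 1}. P (y - of_int n) + of_int n = F y)" for x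
  proof (rule exI[of _ "\<lfloor>x - x0\<rfloor>"], intro conjI ballI)
    have "of_int \<lfloor>x - x0\<rfloor> \<le> x - x0" "x - x0 < of_int \<lfloor>x - x0\<rfloor> + 1" by linarith+
    then show "x \<in> {x0 + of_int \<lfloor>x - x0\<rfloor> - e' <..< x0 + of_int \<lfloor>x - x0\<rfloor> + 1}"
      using e by (auto simp: e'_def algebra_simps)
  qed (auto intro!: loc[symmetric])
  have "Cn m F" for m
  proof (rule Cn_local)
    fix x
    show "\<exists>U g. open U \<and> x \<in> U \<and> Cn m g \<and> (\<forall>y\<in>U. F y = g y)"
      using nb[of x] sh[of m] by metis
  qed
  then have sm: "smooth F" by (simp add: smooth_def)
  have pos: "deriv F x > 0" for x
  proof -
    obtain n :: int where n: "x \<in> {x0 + of_int n - e' <..< x0 + of_int n + 1}"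
      "\<And>y. y \<in> {x0 + of_int n - e' <..< x0 + of_int n + 1} \<Longrightarrow> P (y - of_int n) + of_int n = F y"
      using nb[of x] by blast
    have "((\<lambda>y. P (y - of_int n) + of_int n) has_real_derivative deriv P (x - of_int n)) (at x)"
    proof -
      have "(P has_real_derivative deriv P (x - of_int n)) (at (x - of_int n))"
        using P smooth_DERIV smooth_incr_def by blast
      then have "((\<lambda>y. P (y - of_int n)) has_real_derivative deriv P (x - of_int n) * 1) (at x)"
        by (intro DERIV_chain'[where g = P]) (auto intro!: derivative_eq_intros)
      then show ?thesis by (auto intro!: derivative_eq_intros)
    qed
    then have "(F has_real_derivative deriv P (x - of_int n)) (at x)"
      by (rule has_field_derivative_transform_within_open[OF _ _ n]) auto
    then have "deriv F x = deriv P (x - of_int n)" by (rule DERIV_imp_deriv)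
    then show ?thesis using P by (simp add: smooth_incr_def)
  qed
  have "F (x + 1) = F x + 1" for x
  proof -
    have "\<lfloor>x + 1 - x0\<rfloor> = \<lfloor>x - x0\<rfloor> + 1" by linarith
    then show ?thesis by (simp add: F_def)
  qed
  then have "\<forall>r. diff_lift r F" using sm pos smooth_imp_Cr by (simp add: diff_lift_def)
  moreover have "F x = P x" if "x0 \<le> x" "x \<le> x0 + 1" for x
  proof (cases "x = x0 + 1")
    case True
    have "\<lfloor>x - x0\<rfloor> = 1" using True by simp
    then show ?thesis using per[of x0] e by (simp add: F_def True)
  next
    case False
    then have "\<lfloor>x - x0\<rfloor> = 0" using that by linarith
    then show ?thesis by (simp add: F_def)
  qed
  ultimately show ?thesis by blast
qed

subsection \<open>Orbits of lifts\<close>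

text \<open>The topological part of being a lift. It is stable under composition, inversion and
  integer translation, so it covers words in the generators and their inverses alike.\<close>

definition lift1 :: "(real \<Rightarrow> real) \<Rightarrow> bool" where
  "lift1 g \<longleftrightarrow> continuous_on UNIV g \<and> strict_mono g \<and> (\<forall>x. g (x + 1) = g x + 1)"

text \<open>The case c = 1 serves lifts, the case c = 0 periodic functions.\<close>

lemma shift_int:
  fixes g :: "real \<Rightarrow> real"
  assumes "\<And>x. g (x + 1) = g x + c"
  shows "g (x + of_int n) = g x + of_int n * c"
proof -
  have *: "g (x + of_nat m) = g x + of_nat m * c" for m x
  proof (induction m)
    case (Suc m)
    have "g (x + of_nat (Suc m)) = g ((x + of_nat m) + 1)" by (simp add: algebra_simps)
    then show ?case using Suc assms[of "x + of_nat m"] by (simp add: algebra_simps)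
  qed simp
  show ?thesis
  proof (cases n)
    case (nonneg m) then show ?thesis using * by simp
  next
    case (neg m)
    then have n: "of_int n = - (of_nat (Suc m) :: real)" by simp
    have "g (x + of_int n + of_nat (Suc m)) = g (x + of_int n) + of_nat (Suc m) * c" by (rule *)
    then have "g x = g (x + of_int n) + of_nat (Suc m) * c" by (simp only: n) simp
    then show ?thesis unfolding n by (simp add: algebra_simps)
  qed
qed

lemma lift1_int: "lift1 g \<Longrightarrow> g (x + of_int n) = g x + of_int n"
  using shift_int[of g 1 x n] by (simp add: lift1_def)

lemma lift1_int_diff: "lift1 g \<Longrightarrow> g (x - of_int n) = g x - of_int n"
  using lift1_int[of g x "- n"] by simp

lemma lift1_less_iff: "lift1 g \<Longrightarrow> g x < g y \<longleftrightarrow> x < y"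
  by (simp add: lift1_def strict_mono_less)

lemma lift1_le_iff: "lift1 g \<Longrightarrow> g x \<le> g y \<longleftrightarrow> x \<le> y"
  by (simp add: lift1_def strict_mono_less_eq)

lemma lift1_add_int: "lift1 g \<Longrightarrow> lift1 (\<lambda>x. g x + of_int n)"
  by (auto simp: lift1_def strict_mono_def intro!: continuous_intros)

lemma lift1_comp: "lift1 f \<Longrightarrow> lift1 g \<Longrightarrow> lift1 (\<lambda>x. f (g x))"
  by (auto simp: lift1_def strict_mono_def intro: continuous_on_compose2[of UNIV f])

lemma lift1_surj:
  assumes g: "lift1 g" shows "surj g"
proof -
  have "\<exists>x. g x = y" for y
  proof -
  define n where "n = \<lfloor>y - g 0\<rfloor>"
  have "g (of_int n) = g 0 + of_int n" using lift1_int[OF g, of 0 n] by simp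
  moreover have "g (of_int (n + 1)) = g 0 + of_int (n + 1)" using lift1_int[OF g, of 0 "n + 1"] by simp
  moreover have "of_int n \<le> y - g 0" "y - g 0 < of_int n + 1" unfolding n_def by linarith+
  ultimately have "\<exists>x\<ge>of_int n. x \<le> of_int (n + 1) \<and> g x = y"
    using g by (intro IVT') (auto simp: lift1_def intro: continuous_on_subset)
  then show ?thesis by blast
  qed
  then show ?thesis by (metis surjI)
qed

lemma lift1_f_inv: "lift1 g \<Longrightarrow> g (inv g y) = y"
  by (simp add: lift1_surj surj_f_inv_f)

lemma lift1_inj: "lift1 g \<Longrightarrow> inj g"
  by (simp add: lift1_def strict_mono_imp_inj_on)

lemma lift1_inv_f: "lift1 g \<Longrightarrow> inv g (g x) = x"
  by (simp add: lift1_inj)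

lemma lift1_inv:
  assumes g: "lift1 g" shows "lift1 (inv g)"
proof -
  have sm: "strict_mono (inv g)"
    unfolding strict_mono_def using lift1_less_iff[OF g] lift1_f_inv[OF g] by metis
  moreover have "range (inv g) = UNIV"
    using lift1_inv_f[OF g] by (metis surjI)
  then have "continuous_on UNIV (inv g)"
    by (intro continuous_onI_mono) (use sm in \<open>auto simp: strict_mono_less_eq\<close>)
  moreover have "inv g (x + 1) = inv g x + 1" for x
  proof -
    have "g (inv g x + 1) = x + 1" using g lift1_f_inv[OF g] by (simp add: lift1_def)
    then show ?thesis using lift1_inv_f[OF g] by metis
  qed
  ultimately show ?thesis by (simp add: lift1_def)
qed

text \<open>Unlike \<open>orbit_pt\<close>, this allows the empty word, which makes it reflexive and
  closed under integer translation. A nonempty word then has to be supplied only once along a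
  chain.\<close>

definition reach :: "(real \<Rightarrow> real) list \<Rightarrow> real \<Rightarrow> real \<Rightarrow> bool" where
  "reach Gs x y \<longleftrightarrow> (\<exists>ws n. set ws \<subseteq> set Gs \<and> y = foldr (\<circ>) ws id x + of_int n)"

lemma orbit_pt_iff:
  "y \<in> orbit_pt Gs x \<longleftrightarrow>
    (\<exists>ws n. ws \<noteq> [] \<and> set ws \<subseteq> set Gs \<and> y = foldr (\<circ>) ws id x + of_int n)"
  by (auto simp: orbit_pt_def semigrp_def)

lemma orbit_pt_imp_reach: "y \<in> orbit_pt Gs x \<Longrightarrow> reach Gs x y"
  unfolding orbit_pt_iff reach_def by blast

lemma reach_int: "reach Gs x (x + of_int n)"
  unfolding reach_def by (rule exI[of _ "[]"]) auto

lemma reach_refl: "reach Gs x x"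
  using reach_int[of Gs x 0] by simp

lemma lift1_word: "\<forall>G\<in>set Gs. lift1 G \<Longrightarrow> set ws \<subseteq> set Gs \<Longrightarrow> lift1 (foldr (\<circ>) ws id)"
proof (induction ws)
  case Nil
  then show ?case by (simp add: lift1_def strict_mono_def)
next
  case (Cons G ws)
  have eq: "foldr (\<circ>) (G # ws) id = (\<lambda>x. G (foldr (\<circ>) ws id x))" by (simp add: fun_eq_iff)
  have "lift1 (foldr (\<circ>) ws id)" by (rule Cons.IH) (use Cons.prems in auto)
  then show ?case unfolding eq using Cons.prems by (intro lift1_comp[of G "foldr (\<circ>) ws id"]) auto
qed

lemma word_append: "foldr (\<circ>) (vs @ ws) id x = foldr (\<circ>) vs id (foldr (\<circ>) ws id x)"
  by (induction vs) auto

lemma reach_compose: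
  assumes "\<forall>G\<in>set Gs. lift1 G" "set vs \<subseteq> set Gs"
  shows "foldr (\<circ>) vs id (foldr (\<circ>) ws id x + of_int n) + of_int m =
    foldr (\<circ>) (vs @ ws) id x + of_int (n + m)"
  using lift1_int[OF lift1_word[OF assms]] by (simp add: word_append del: foldr_append)

lemma reach_trans:
  assumes "\<forall>G\<in>set Gs. lift1 G" "reach Gs x y" "reach Gs y z"
  shows "reach Gs x z"
proof -
  obtain ws n vs m where w: "set ws \<subseteq> set Gs" "y = foldr (\<circ>) ws id x + of_int n"
    "set vs \<subseteq> set Gs" "z = foldr (\<circ>) vs id y + of_int m"
    using assms(2,3) unfolding reach_def by blast
  then have "z = foldr (\<circ>) (vs @ ws) id x + of_int (n + m)" 
    using reach_compose[OF assms(1), of vs ws x n m] by (simp del: foldr_append)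
  then show ?thesis using w unfolding reach_def 
    by (intro exI[of _ "vs @ ws"] exI[of _ "n + m"]) (simp del: foldr_append)
qed

lemma orbit_pt_reach:
  assumes "\<forall>G\<in>set Gs. lift1 G" "y \<in> orbit_pt Gs x" "reach Gs y z"
  shows "z \<in> orbit_pt Gs x"
proof -
  obtain ws n vs m where w: "ws \<noteq> []" "set ws \<subseteq> set Gs" "y = foldr (\<circ>) ws id x + of_int n"
    "set vs \<subseteq> set Gs" "z = foldr (\<circ>) vs id y + of_int m"
    using assms(2,3) unfolding reach_def orbit_pt_iff by blast
  then have "z = foldr (\<circ>) (vs @ ws) id x + of_int (n + m)" 
    using reach_compose[OF assms(1), of vs ws x n m] by (simp del: foldr_append)
  then show ?thesis using w unfolding orbit_pt_iff 
    by (intro exI[of _ "vs @ ws"] exI[of _ "n + m"]) (simp del: foldr_append)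
qed

lemma reach_orbit_pt:
  assumes "\<forall>G\<in>set Gs. lift1 G" "reach Gs x y" "z \<in> orbit_pt Gs y"
  shows "z \<in> orbit_pt Gs x"
proof -
  obtain ws n vs m where w: "vs \<noteq> []" "set ws \<subseteq> set Gs" "y = foldr (\<circ>) ws id x + of_int n"
    "set vs \<subseteq> set Gs" "z = foldr (\<circ>) vs id y + of_int m"
    using assms(2,3) unfolding reach_def orbit_pt_iff by blast
  then have "z = foldr (\<circ>) (vs @ ws) id x + of_int (n + m)" 
    using reach_compose[OF assms(1), of vs ws x n m] by (simp del: foldr_append)
  then show ?thesis using w unfolding orbit_pt_iff 
    by (intro exI[of _ "vs @ ws"] exI[of _ "n + m"]) (simp del: foldr_append)
qed

lemma generator_orbit_pt: "G \<in> set Gs \<Longrightarrow> G x + of_int n \<in> orbit_pt Gs x"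
  unfolding orbit_pt_iff by (intro exI[of _ "[G]"]) auto

text \<open>Hutchinson's argument: the compositions of the contractions in \<open>\<Phi>\<close> along the codings of a
  point of \<open>J\<close> bring every point of \<open>L\<close> arbitrarily close to it.\<close>

lemma orbit_dense_criterion:
  assumes lifts: "\<forall>G\<in>set Gs. lift1 G"
    and gen: "\<And>f z. f \<in> \<Phi> \<Longrightarrow> f z \<in> orbit_pt Gs z"
    and c: "0 \<le> c" "c < 1"
    and contr: "\<And>f x y. f \<in> \<Phi> \<Longrightarrow> x \<in> L \<Longrightarrow> y \<in> L \<Longrightarrow> \<bar>f x - f y\<bar> \<le> c * \<bar>x - y\<bar>"
    and into: "\<And>f x. f \<in> \<Phi> \<Longrightarrow> x \<in> L \<Longrightarrow> f x \<in> L"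
    and cover: "\<And>y. y \<in> J \<Longrightarrow> \<exists>f\<in>\<Phi>. \<exists>y'\<in>J. f y' = y"
    and JL: "J \<subseteq> L" and B: "\<And>x y. x \<in> L \<Longrightarrow> y \<in> L \<Longrightarrow> \<bar>x - y\<bar> \<le> B"
    and bwd: "\<And>V. open V \<Longrightarrow> V \<noteq> {} \<Longrightarrow> \<exists>y\<in>J. \<exists>v\<in>V. reach Gs y v"
    and x0: "x0 \<in> L" "x0 \<in> orbit_pt Gs x"
  shows "closure (orbit_pt Gs x) = UNIV"
proof -
  \<comment> \<open>If y = f y' and z approximates y', then f z approximates y with the error
    reduced by the factor c.\<close>
  have approx: "\<exists>z\<in>L. z \<in> orbit_pt Gs x \<and> \<bar>z - y\<bar> \<le> c ^ n * B" if "y \<in> J" for n y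
    using that
  proof (induction n arbitrary: y)
    case 0
    then show ?case using x0 JL B by auto
  next
    case (Suc n)
    then obtain f y' where f: "f \<in> \<Phi>" "y' \<in> J" "f y' = y" using cover by blast
    then obtain z where z: "z \<in> L" "z \<in> orbit_pt Gs x" "\<bar>z - y'\<bar> \<le> c ^ n * B"
      using Suc.IH by blast
    have "f z \<in> orbit_pt Gs x"
      using orbit_pt_reach[OF lifts z(2)] gen[OF f(1)] orbit_pt_imp_reach by blast
    moreover have "\<bar>f z - y\<bar> \<le> c ^ Suc n * B"
    proof -
      have "\<bar>f z - y\<bar> \<le> c * \<bar>z - y'\<bar>" using contr[OF f(1) z(1), of y'] f JL by auto
      also have "\<dots> \<le> c * (c ^ n * B)" using z c by (intro mult_left_mono) auto
      finally show ?thesis by (simp add: mult.assoc)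
    qed
    ultimately show ?case using into[OF f(1) z(1)] by blast
  qed
  have "\<exists>v\<in>V. v \<in> orbit_pt Gs x" if V: "open V" "V \<noteq> {}" for V
  proof -
    obtain y v where y: "y \<in> J" "v \<in> V" "reach Gs y v" using bwd[OF V] by blast
    then obtain ws n where w: "set ws \<subseteq> set Gs" "v = foldr (\<circ>) ws id y + of_int n"
      unfolding reach_def by blast
    \<comment> \<open>The word that leads y into V also leads a neighbourhood of y into V, so
      approximating y by the orbit is enough.\<close>
    define h where "h = (\<lambda>z. foldr (\<circ>) ws id z + of_int n)"
    have "continuous_on UNIV h"
      unfolding h_def using lift1_word[OF lifts w(1)] by (auto simp: lift1_def intro!: continuous_intros)
    then have "open (h -` V)" using V(1) open_vimage by blast
    moreover have "y \<in> h -` V" using y w by (simp add: h_def)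
    ultimately obtain e where e: "e > 0" "\<And>z. \<bar>z - y\<bar> < e \<Longrightarrow> h z \<in> V"
      unfolding open_real by (auto simp: open_dist dist_real_def)
    have "(\<lambda>k. c ^ k * B) \<longlonglongrightarrow> 0 * B"
      by (intro tendsto_mult LIMSEQ_power_zero tendsto_const) (use c in auto)
    then have "\<forall>\<^sub>F k in sequentially. c ^ k * B < e"
      using e(1) order_tendstoD(2)[of _ "0::real"] by auto
    then obtain k where k: "c ^ k * B < e" using eventually_happens'[OF sequentially_bot] by blast
    obtain z where z: "z \<in> orbit_pt Gs x" "\<bar>z - y\<bar> \<le> c ^ k * B" using approx[OF y(1)] by blast
    have "h z \<in> V" using e(2) z(2) k by simp
    moreover have "reach Gs z (h z)" using w(1) unfolding reach_def h_def by blast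
    ultimately show ?thesis using orbit_pt_reach[OF lifts z(1)] by blast
  qed
  from this[of "- closure (orbit_pt Gs x)"] show ?thesis
    using closure_subset by fastforce
qed

lemma transitive_if_dense_orbits:
  assumes "\<And>U. open U \<Longrightarrow> U \<noteq> {} \<Longrightarrow> \<exists>u\<in>U. closure (orbit_pt Gs u) = UNIV"
  shows "ifs_transitive Gs"
  unfolding ifs_transitive_def
proof (intro allI impI)
  fix U :: "real set" assume "open U \<and> U \<noteq> {}"
  then obtain u where u: "u \<in> U" "closure (orbit_pt Gs u) = UNIV" using assms by blast
  have "orbit_pt Gs u \<subseteq> {h u + of_int n | h u n. h \<in> semigrp Gs \<and> u \<in> U}"
    using u(1) unfolding orbit_pt_def by blast
  then show "closure {h u + of_int n | h u n. h \<in> semigrp Gs \<and> u \<in> U} = UNIV"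
    using u(2) closure_mono by blast
qed

lemma minimal_imp_transitive: "ifs_minimal Gs \<Longrightarrow> ifs_transitive Gs"
  by (rule transitive_if_dense_orbits) (auto simp: ifs_minimal_def)

text \<open>If no image of U left N, the images of an interval in U could be doubled again and
  again, each time with a map from \<open>T\<close> suited to the current image, although intervals
  in N have length at most 1.\<close>

lemma expansion_leaves:
  fixes N :: "real set"
  assumes id: "(\<lambda>x. x) \<in> T"
    and comp: "\<And>s t. s \<in> T \<Longrightarrow> t \<in> T \<Longrightarrow> (\<lambda>x. s (t x)) \<in> T"
    and lift: "\<And>t. t \<in> T \<Longrightarrow> lift1 t"
    and expand: "\<And>x y. x < y \<Longrightarrow> {x..y} \<subseteq> N \<Longrightarrow> y - x \<le> 1 \<and> (\<exists>t\<in>T. 2 * (y - x) \<le> t y - t x)"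
    and U: "open U" "U \<noteq> {}"
  shows "\<exists>t\<in>T. \<exists>z\<in>U. t z \<notin> N"
proof (rule ccontr)
  assume "\<not> ?thesis"
  then have in_N: "t z \<in> N" if "t \<in> T" "z \<in> U" for t z
    using that by blast
  obtain u where "u \<in> U" using U by blast
  then obtain e where e: "e > 0" "cball u e \<subseteq> U" using U open_contains_cball by blast
  define x y where "x = u" and "y = u + e"
  have xy: "x < y" "{x..y} \<subseteq> U"
    using e by (auto simp: x_def y_def dist_real_def intro!: subsetD[OF e(2)])
  have img: "{t x..t y} \<subseteq> N" if t: "t \<in> T" for t
  proof
    fix w assume w: "w \<in> {t x..t y}"
    have L: "lift1 t" by (rule lift[OF t])
    have "inv t w \<in> {x..y}"
      using w lift1_le_iff[OF L, of x "inv t w"] lift1_le_iff[OF L, of "inv t w" y] lift1_f_inv[OF L]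
      by simp
    then have "inv t w \<in> U" using xy by blast
    then show "w \<in> N" using in_N[OF t] lift1_f_inv[OF L] by metis
  qed
  have grow: "\<exists>t\<in>T. 2 ^ n * (y - x) \<le> t y - t x" for n
  proof (induction n)
    case 0
    then show ?case using id by (intro bexI[of _ "\<lambda>x. x"]) auto
  next
    case (Suc n)
    then obtain t where t: "t \<in> T" "2 ^ n * (y - x) \<le> t y - t x" by blast
    have "t x < t y" using lift1_less_iff[OF lift[OF t(1)]] xy by simp
    from expand[OF this img[OF t(1)]]
    obtain s where s: "s \<in> T" "2 * (t y - t x) \<le> s (t y) - s (t x)" by blast
    then have "2 ^ Suc n * (y - x) \<le> s (t y) - s (t x)" using t(2) by simp
    then show ?case using comp[OF s(1) t(1)] by (intro bexI[of _ "\<lambda>x. s (t x)"]) auto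
  qed
  obtain n where n: "1 / (y - x) < 2 ^ n" using real_arch_pow[of 2 "1 / (y - x)"] by auto
  obtain t where t: "t \<in> T" "2 ^ n * (y - x) \<le> t y - t x" using grow by blast
  have "t x < t y" using lift1_less_iff[OF lift[OF t(1)]] xy by simp
  from expand[OF this img[OF t(1)]] have "t y - t x \<le> 1" by blast
  moreover have "1 < 2 ^ n * (y - x)" using n xy by (simp add: field_simps)
  ultimately show False using t(2) by linarith
qed

subsection \<open>Perturbations\<close>

lemma diff_lift_DERIV: "1 \<le> r \<Longrightarrow> diff_lift r F \<Longrightarrow> (F has_real_derivative deriv F x) (at x)"
proof -
  assume r: "1 \<le> r" and F: "diff_lift r F"
  have "enat 0 < r" using r by (metis one_enat_def enat_ord_simps(2) less_le_trans zero_less_one)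
  moreover have "\<forall>j. enat j < r \<longrightarrow> (\<forall>x. (deriv ^^ j) F differentiable (at x))"
    using F unfolding diff_lift_def Cr_def by blast
  ultimately have "((deriv ^^ 0) F) differentiable (at x)" by blast
  then show ?thesis by (auto simp: real_differentiable_def DERIV_imp_deriv)
qed

lemma diff_lift_lift1: assumes "1 \<le> r" "diff_lift r F" shows "lift1 F"
proof -
  note D = diff_lift_DERIV[OF assms]
  have "strict_mono F"
    unfolding strict_mono_def
  proof (intro allI impI)
    fix x y :: real assume "x < y"
    then show "F x < F y"
      by (rule DERIV_pos_imp_increasing) (use D assms in \<open>auto simp: diff_lift_def\<close>)
  qed
  moreover have "continuous_on UNIV F"
    using D DERIV_isCont by (intro continuous_at_imp_continuous_on) blast
  ultimately show ?thesis using assms by (auto simp: lift1_def diff_lift_def)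
qed

section \<open>Boundedness of the terms of the metric\<close>

lemma deriv_add_const: "deriv (\<lambda>x. f x + c) x = deriv (f :: real \<Rightarrow> real) x"
proof -
  have "((\<lambda>x. f x + c) has_real_derivative D) (at x) \<longleftrightarrow> (f has_real_derivative D) (at x)" for D
  proof
    assume "((\<lambda>x. f x + c) has_real_derivative D) (at x)"
    from DERIV_diff[OF this DERIV_const[of c]] show "(f has_real_derivative D) (at x)" by simp
  next
    assume "(f has_real_derivative D) (at x)"
    from DERIV_add[OF this DERIV_const[of c]] show "((\<lambda>x. f x + c) has_real_derivative D) (at x)"
      by simp
  qed
  then show ?thesis by (simp add: deriv_def)
qed

lemma deriv_shift: "deriv (\<lambda>x. f (x + c)) x = deriv (f :: real \<Rightarrow> real) (x + c)"
  by (simp add: deriv_def DERIV_shift)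

lemma deriv_iter_periodic:
  fixes F :: "real \<Rightarrow> real"
  assumes "\<And>x. F (x + 1) = F x + 1" "j > 0"
  shows "(deriv ^^ j) F (x + 1) = (deriv ^^ j) F x"
  using assms(2)
proof (induction j arbitrary: x)
  case (Suc j)
  show ?case
  proof (cases "j = 0")
    case True
    have "deriv F (x + 1) = deriv (\<lambda>x. F (x + 1)) x" by (simp add: deriv_shift)
    also have "\<dots> = deriv F x" by (simp add: assms deriv_add_const)
    finally show ?thesis using True by simp
  next
    case False
    have "deriv ((deriv ^^ j) F) (x + 1) = deriv (\<lambda>x. (deriv ^^ j) F (x + 1)) x"
      by (simp add: deriv_shift)
    then show ?thesis using Suc.IH False by simp
  qed
qed simp

lemma continuous_periodic_bounded:
  fixes h :: "real \<Rightarrow> real"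
  assumes "continuous_on UNIV h" "\<And>x. h (x + 1) = h x"
  shows "\<exists>B. \<forall>x. \<bar>h x\<bar> \<le> B"
proof -
  have "compact (h ` {0..1})"
    using assms(1) by (intro compact_continuous_image) (auto intro: continuous_on_subset)
  then obtain B where B: "\<And>x. x \<in> {0..1} \<Longrightarrow> \<bar>h x\<bar> \<le> B"
    using compact_imp_bounded bounded_iff by (metis image_eqI real_norm_def)
  have "\<bar>h x\<bar> \<le> B" for x
  proof -
    have "h (x + of_int (- \<lfloor>x\<rfloor>)) = h x + of_int (- \<lfloor>x\<rfloor>) * 0"
      by (rule shift_int) (simp add: assms)
    moreover have "x + of_int (- \<lfloor>x\<rfloor>) \<in> {0..1}" by auto linarith
    ultimately show ?thesis using B by fastforce
  qed
  then show ?thesis by blast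
qed

lemma circ_dist_bounds: "0 \<le> circ_dist x y" "circ_dist x y \<le> 1"
proof -
  show "0 \<le> circ_dist x y" unfolding circ_dist_def by (rule cINF_greatest) auto
  have "circ_dist x y \<le> \<bar>x - y - of_int \<lfloor>x - y\<rfloor>\<bar>"
    unfolding circ_dist_def by (rule cINF_lower) (auto intro!: bdd_belowI[of _ 0])
  then show "circ_dist x y \<le> 1" by linarith
qed

lemma circ_dist_less: "circ_dist x y < e \<Longrightarrow> \<exists>n::int. \<bar>x - y - of_int n\<bar> < e"
  unfolding circ_dist_def by (subst (asm) cINF_less_iff) (auto intro!: bdd_belowI[of _ 0])

lemma dist_0_ge: "circ_dist (F x) (G x) \<le> dist_j 0 F G"
  unfolding dist_j_def
  by (auto intro!: cSUP_upper bdd_aboveI[of _ 1] simp: circ_dist_bounds)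

text \<open>A real \<open>SUP\<close> dominates its members only when they are bounded above; here
  continuity and periodicity of the derivatives provide the bound.\<close>

lemma dist_j_ge:
  assumes "diff_lift r F" "diff_lift r G" "enat j \<le> r" "j > 0"
  shows "\<bar>(deriv ^^ j) F x - (deriv ^^ j) G x\<bar> \<le> dist_j j F G"
proof -
  have c: "continuous_on UNIV ((deriv ^^ j) F)" "continuous_on UNIV ((deriv ^^ j) G)"
    using assms by (auto simp: diff_lift_def Cr_def)
  have "\<exists>B. \<forall>x. \<bar>(deriv ^^ j) F x - (deriv ^^ j) G x\<bar> \<le> B"
    by (rule continuous_periodic_bounded)
      (use assms c in \<open>auto intro!: continuous_intros simp: deriv_iter_periodic diff_lift_def\<close>)
  then have "bdd_above (range (\<lambda>x. \<bar>(deriv ^^ j) F x - (deriv ^^ j) G x\<bar>))"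
    by (auto intro: bdd_aboveI)
  then show ?thesis unfolding dist_j_def using assms(4) by (auto intro: cSUP_upper)
qed

lemma dist_j_nonneg:
  assumes "diff_lift r F" "diff_lift r G" "enat j \<le> r"
  shows "0 \<le> dist_j j F G"
proof (cases "j = 0")
  case True
  then show ?thesis using dist_0_ge[of F 0 G] circ_dist_bounds(1) by (metis order_trans)
next
  case False
  then show ?thesis using dist_j_ge[OF assms, of 0] by (simp add: order_trans[OF abs_ge_zero])
qed

lemma summable_weighted_min:
  fixes a :: "nat \<Rightarrow> real"
  assumes "\<And>j. 0 \<le> a j"
  shows "summable (\<lambda>j. (1/2) ^ j * min 1 (a j))"
proof (rule summable_comparison_test'[where N = 0])
  show "summable (\<lambda>j. (1/2::real) ^ j)" by (simp add: summable_geometric)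
qed (use assms in \<open>auto simp: min_def\<close>)

text \<open>The factor 2 undoes the weight 1/2 of the first derivative in the series for r =
  \<infinity>. Since 2 * e is at most 1, the truncation \<open>min 1\<close> cannot hide a larger
  distance.\<close>

lemma d_r_bounds:
  assumes "1 \<le> r" and F: "diff_lift r F" and G: "diff_lift r G"
  shows "0 \<le> d_r r F G"
    and "e \<le> 1/2 \<Longrightarrow> d_r r F G < e \<Longrightarrow> dist_j 0 F G < 2 * e \<and> dist_j 1 F G < 2 * e"
proof -
  note nn = dist_j_nonneg[OF F G]
  show "0 \<le> d_r r F G"
  proof (cases r)
    case (enat m)
    then show ?thesis unfolding d_r_def by (auto intro!: sum_nonneg nn)
  next
    case infinity
    have nn: "0 \<le> dist_j j F G" for j by (rule nn) (simp add: infinity)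
    note summable_dist = summable_weighted_min[of "\<lambda>j. dist_j j F G", OF nn]
    then show ?thesis unfolding d_r_def using nn infinity by (auto intro!: suminf_nonneg summable_dist)
  qed
  assume e: "e \<le> 1/2" "d_r r F G < e"
  show "dist_j 0 F G < 2 * e \<and> dist_j 1 F G < 2 * e"
  proof (cases r)
    case (enat m)
    have m: "1 \<le> m" using assms(1) enat by (simp add: one_enat_def)
    have "sum (\<lambda>j. dist_j j F G) {0, 1} \<le> sum (\<lambda>j. dist_j j F G) {0..m}"
      using m by (intro sum_mono2) (auto intro!: nn simp: enat)
    then have "dist_j 0 F G + dist_j 1 F G < e" using e enat by (simp add: d_r_def)
    moreover have "0 \<le> dist_j 0 F G" "0 \<le> dist_j 1 F G" using m by (auto intro!: nn simp: enat)
    ultimately show ?thesis by linarith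
  next
    case infinity
    have nn: "0 \<le> dist_j j F G" for j by (rule nn) (simp add: infinity)
    note summable_dist = summable_weighted_min[of "\<lambda>j. dist_j j F G", OF nn]
    have "sum (\<lambda>j. (1/2) ^ j * min 1 (dist_j j F G)) {0, 1}
        \<le> (\<Sum>j. (1/2) ^ j * min 1 (dist_j j F G))"
      by (rule sum_le_suminf[OF summable_dist]) (use nn in auto)
    also have "\<dots> = d_r r F G" by (simp add: d_r_def infinity)
    finally have "min 1 (dist_j 0 F G) + min 1 (dist_j 1 F G) / 2 < e" using e by simp
    moreover have "0 \<le> min 1 (dist_j 0 F G)" "0 \<le> min 1 (dist_j 1 F G)" using nn by auto
    ultimately have "min 1 (dist_j 0 F G) < 2 * e" "min 1 (dist_j 1 F G) < 2 * e" by linarith+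
    then show ?thesis using e by linarith
  qed
qed

text \<open>C^1-closeness stated through increments instead of derivatives. The map g stands for a
  generator of \<open>Gs\<close> composed with a suitable integer translation, which is why it is
  tied to \<open>Gs\<close> only through orbits.\<close>

definition near :: "(real \<Rightarrow> real) list \<Rightarrow> real \<Rightarrow> (real \<Rightarrow> real) \<Rightarrow> (real \<Rightarrow> real) \<Rightarrow> bool" where
  "near Gs e F g \<longleftrightarrow> lift1 g \<and> (\<forall>z. g z \<in> orbit_pt Gs z) \<and> (\<forall>x. \<bar>g x - F x\<bar> \<le> e) \<and>
    (\<forall>x y. x \<le> y \<longrightarrow> \<bar>(g y - g x) - (F y - F x)\<bar> \<le> e * (y - x))"

lemma near_mono:
  assumes "near Gs d F g" "d \<le> e" shows "near Gs e F g"
  unfolding near_def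
proof (intro conjI allI impI)
  fix x y :: real
  show "\<bar>g x - F x\<bar> \<le> e" using assms order_trans unfolding near_def by blast
  assume "x \<le> y"
  then have "d * (y - x) \<le> e * (y - x)" using assms(2) by (intro mult_right_mono) auto
  then show "\<bar>(g y - g x) - (F y - F x)\<bar> \<le> e * (y - x)"
    using assms(1) \<open>x \<le> y\<close> order_trans unfolding near_def by blast
qed (use assms in \<open>auto simp: near_def\<close>)

lemma near_refl: "e \<ge> 0 \<Longrightarrow> lift1 F \<Longrightarrow> F \<in> set Gs \<Longrightarrow> near Gs e F F"
  using generator_orbit_pt[of F Gs _ 0] by (simp add: near_def)

text \<open>The closest integer may a priori vary with the point; the derivative bound makes it constant
  at the cost of a larger error.\<close>

lemma near_if_d_r_less:
  assumes r: "1 \<le> r" and F: "diff_lift r F" and G: "diff_lift r G" "G \<in> set Gs"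
    and e: "0 < e" "e \<le> 1/2" and d: "d_r r F G < e"
  shows "\<exists>g. near Gs (4 * e) F g"
proof -
  have d0: "dist_j 0 F G < 2 * e" and d1: "dist_j 1 F G < 2 * e"
    using d_r_bounds(2)[OF r F G(1) e(2) d] by auto
  have "\<bar>(deriv ^^ 1) F x - (deriv ^^ 1) G x\<bar> \<le> dist_j 1 F G" for x
    using r by (intro dist_j_ge[OF F G(1)]) (auto simp: one_enat_def)
  then have der: "\<bar>deriv G x - deriv F x\<bar> \<le> 2 * e" for x
    using d1 by (simp add: abs_minus_commute) (meson less_imp_le order_trans)
  have inc: "\<bar>(G y - G x) - (F y - F x)\<bar> \<le> 2 * e * (y - x)" if xy: "x \<le> y" for x y
  proof (cases "x < y")
    case True
    have D: "((\<lambda>x. G x - F x) has_real_derivative deriv G x - deriv F x) (at x)" for x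
      by (intro DERIV_diff diff_lift_DERIV[OF r] F G)
    obtain z where z: "(G y - F y) - (G x - F x) = (y - x) * (deriv G z - deriv F z)"
      using MVT2[OF True, of "\<lambda>x. G x - F x" "\<lambda>x. deriv G x - deriv F x"] D by blast
    have "(y - x) * \<bar>deriv G z - deriv F z\<bar> \<le> (y - x) * (2 * e)"
      using der[of z] xy by (intro mult_left_mono) auto
    moreover have "(G y - G x) - (F y - F x) = (y - x) * (deriv G z - deriv F z)"
      using z by (simp add: algebra_simps)
    then have "\<bar>(G y - G x) - (F y - F x)\<bar> = (y - x) * \<bar>deriv G z - deriv F z\<bar>"
      using xy by (simp add: abs_mult)
    ultimately show ?thesis by (simp add: mult.commute)
  qed (use xy in simp)
  have "circ_dist (F 0) (G 0) < 2 * e" using dist_0_ge[of F 0 G] d0 by linarith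
  then obtain n :: int where n: "\<bar>F 0 - G 0 - of_int n\<bar> < 2 * e" using circ_dist_less by blast
  define g where "g = (\<lambda>x. G x + of_int n)"
  have lF: "lift1 F" and lG: "lift1 G" using diff_lift_lift1 r F G by auto
  have "\<bar>g x - F x\<bar> \<le> 4 * e" for x
  proof -
    \<comment> \<open>The function g - F is 1-periodic, so one period suffices: the error is at most
      2 * e at 0 plus 2 * e from the increment.\<close>
    define y where "y = x - of_int \<lfloor>x\<rfloor>"
    have y: "0 \<le> y" "y \<le> 1" unfolding y_def by linarith+
    have "g x - F x = g y - F y"
      unfolding g_def y_def by (simp add: lift1_int_diff lF lG)
    moreover have "2 * e * (y - 0) \<le> 2 * e" using y e by simp
    then have "\<bar>(G y - G 0) - (F y - F 0)\<bar> \<le> 2 * e" using inc[OF y(1)] by linarith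
    ultimately show ?thesis using n unfolding g_def by linarith
  qed
  moreover have "\<bar>(g y - g x) - (F y - F x)\<bar> \<le> 4 * e * (y - x)" if "x \<le> y" for x y
  proof -
    have "2 * e * (y - x) \<le> 4 * e * (y - x)" using that e by (intro mult_right_mono) auto
    then show ?thesis using inc[OF that] by (simp add: g_def)
  qed
  moreover have "lift1 g" unfolding g_def by (rule lift1_add_int[OF lG])
  moreover have "g z \<in> orbit_pt Gs z" for z
    unfolding g_def by (rule generator_orbit_pt[OF G(2)])
  ultimately show ?thesis unfolding near_def by blast
qed

text \<open>The minimum in \<open>dbar\<close> is attained by some matching, and as all summands are
  nonnegative each matched pair is as close as the whole sum.\<close>

lemma RT_if_near_transitive:
  assumes r: "1 \<le> r" and Fs: "IFS r k Fs" and e: "e > 0"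
    and trans: "\<And>Gs. \<forall>G\<in>set Gs. lift1 G \<Longrightarrow> \<forall>F\<in>set Fs. \<exists>g. near Gs e F g \<Longrightarrow> ifs_transitive Gs"
  shows "RT r k Fs"
  unfolding RT_def
proof (intro conjI exI allI impI)
  \<comment> \<open>The quotient e / 4 compensates the factor 4 in \<open>near_if_d_r_less\<close>,
    and 1/2 is the bound required there.\<close>
  define \<delta> where "\<delta> = min (e / 4) (1/2)"
  show "\<delta> > 0" using e by (simp add: \<delta>_def)
  fix Gs assume "IFS r k Gs \<and> dbar r Fs Gs < \<delta>"
  then have Gs: "IFS r k Gs" and db: "dbar r Fs Gs < \<delta>" by auto
  define f where "f = (\<lambda>\<sigma>. \<Sum>i<length Fs. d_r r (Fs ! i) (Gs ! (\<sigma> i)))"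
  define P where "P = {\<sigma>. \<sigma> permutes {..<length Fs}}"
  have "dbar r Fs Gs = Min (f ` P)"
    by (simp add: dbar_def f_def P_def setcompr_eq_image)
  moreover have "finite P" by (simp add: P_def finite_permutations)
  moreover have "id \<in> P" by (simp add: P_def permutes_id)
  ultimately have "dbar r Fs Gs \<in> f ` P" using Min_in[of "f ` P"] by (metis empty_iff finite_imageI image_is_empty)
  then obtain \<sigma> where "\<sigma> \<in> P" "dbar r Fs Gs = f \<sigma>" by (rule imageE)
  then have \<sigma>: "\<sigma> permutes {..<length Fs}"
    and sum: "(\<Sum>i<length Fs. d_r r (Fs ! i) (Gs ! (\<sigma> i))) < \<delta>"
    using db by (simp_all add: P_def f_def)
  have len: "length Gs = length Fs" using Fs Gs by (simp add: IFS_def)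
  have G: "Gs ! (\<sigma> i) \<in> set Gs" if "i < length Fs" for i
    using permutes_in_image[OF \<sigma>, of i] that len by simp
  have dl: "diff_lift r (Fs ! i)" "diff_lift r (Gs ! (\<sigma> i))" if "i < length Fs" for i
    using Fs Gs G[OF that] that by (auto simp: IFS_def)
  show "ifs_transitive Gs"
  proof (rule trans)
    show "\<forall>G\<in>set Gs. lift1 G" using Gs diff_lift_lift1[OF r] by (auto simp: IFS_def)
    show "\<forall>F\<in>set Fs. \<exists>g. near Gs e F g"
    proof
      fix F assume "F \<in> set Fs"
      then obtain i where i: "i < length Fs" "F = Fs ! i" by (metis in_set_conv_nth)
      have "d_r r (Fs ! i) (Gs ! (\<sigma> i)) \<le> (\<Sum>i<length Fs. d_r r (Fs ! i) (Gs ! (\<sigma> i)))"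
        by (rule member_le_sum) (use i dl d_r_bounds(1)[OF r] in auto)
      then have d: "d_r r (Fs ! i) (Gs ! (\<sigma> i)) < \<delta>" using sum by simp
      have "\<delta> \<le> 1/2" "4 * \<delta> \<le> e" by (simp_all add: \<delta>_def)
      then show "\<exists>g. near Gs e F g"
        using near_if_d_r_less[OF r dl(1)[OF i(1)] dl(2)[OF i(1)] G[OF i(1)] \<open>\<delta> > 0\<close> _ d]
          near_mono i(2) by blast
    qed
  qed
qed (rule Fs)

lemma near_lift1: "near Gs e F g \<Longrightarrow> lift1 g"
  and near_orbit: "near Gs e F g \<Longrightarrow> g z \<in> orbit_pt Gs z"
  and near_value: "near Gs e F g \<Longrightarrow> F x - e \<le> g x" "near Gs e F g \<Longrightarrow> g x \<le> F x + e"
  by (auto simp: near_def abs_le_iff diff_le_eq le_diff_eq add.commute)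

lemma near_affine:
  assumes "near Gs e F g" "x \<le> y" "F x = c * x + d" "F y = c * y + d"
  shows "(c - e) * (y - x) \<le> g y - g x" "g y - g x \<le> (c + e) * (y - x)"
proof -
  have "\<bar>(g y - g x) - (F y - F x)\<bar> \<le> e * (y - x)" using assms(1,2) by (simp add: near_def)
  moreover have "F y - F x = c * (y - x)" using assms by (simp add: algebra_simps)
  ultimately show "(c - e) * (y - x) \<le> g y - g x" "g y - g x \<le> (c + e) * (y - x)"
    by (simp_all add: algebra_simps abs_le_iff)
qed

lemma near_contraction:
  assumes n: "near Gs e F g" and F: "\<And>x. x \<in> L \<Longrightarrow> F x = c * x + d" and xy: "x \<in> L" "y \<in> L"
  shows "\<bar>g x - g y\<bar> \<le> (c + e) * \<bar>x - y\<bar>"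
proof -
  have *: "\<bar>g x - g y\<bar> \<le> (c + e) * \<bar>x - y\<bar>" if "x \<le> y" "x \<in> L" "y \<in> L" for x y
    using near_affine(2)[OF n that(1) F F] lift1_le_iff[OF near_lift1[OF n], of x y] that by simp
  show ?thesis using *[of x y] *[of y x] xy
    by (cases "x \<le> y") (simp_all add: abs_minus_commute)
qed

lemma near_preimage:
  assumes n: "near Gs e F g" and "F l + e \<le> y" "y \<le> F u - e"
  shows "l \<le> inv g y" "inv g y \<le> u"
proof -
  have "g l \<le> g (inv g y)" "g (inv g y) \<le> g u"
    using near_value[OF n, of l] near_value[OF n, of u] assms lift1_f_inv[OF near_lift1[OF n], of y]
    by linarith+
  then show "l \<le> inv g y" "inv g y \<le> u" using lift1_le_iff[OF near_lift1[OF n]] by auto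
qed

text \<open>The margin e at both ends keeps the preimages of v and w in the window [l, u], where g
  has slope at most c + e.\<close>

lemma near_inv_expands:
  assumes n: "near Gs e F g" and F: "\<And>x. l \<le> x \<Longrightarrow> x \<le> u \<Longrightarrow> F x = c * x + d"
    and ce: "c + e \<le> 1 / K" "0 < K"
    and v: "v \<le> w" "F l + e \<le> v" "w \<le> F u - e"
  shows "K * (w - v) \<le> inv g w - inv g v"
proof -
  have L: "lift1 g" by (rule near_lift1[OF n])
  have le: "inv g v \<le> inv g w" using lift1_le_iff[OF lift1_inv[OF L]] v by blast
  have "v \<le> F u - e" "F l + e \<le> w" using v by linarith+
  with near_preimage[OF n, of l v u] near_preimage[OF n, of l w u] v
  have "F (inv g v) = c * inv g v + d" "F (inv g w) = c * inv g w + d" by (auto intro!: F)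
  then have "w - v \<le> (c + e) * (inv g w - inv g v)"
    using near_affine(2)[OF n le] lift1_f_inv[OF L] by metis
  also have "\<dots> \<le> (1 / K) * (inv g w - inv g v)"
    using le ce by (intro mult_right_mono) auto
  finally show ?thesis using ce by (simp add: field_simps)
qed

lemma near_inv_reach:
  assumes "\<forall>G\<in>set Gs. lift1 G" "near Gs e F g"
  shows "reach Gs (inv g z) z"
  using near_orbit[OF assms(2), of "inv g z"] lift1_f_inv[OF near_lift1[OF assms(2)], of z]
  by (simp add: orbit_pt_imp_reach)

lemma near_reach: "near Gs e F g \<Longrightarrow> reach Gs z (g z)"
  using near_orbit orbit_pt_imp_reach by blast

lemma expansion_leaves_forward:
  assumes lifts: "\<forall>G\<in>set Gs. lift1 G"
    and expand: "\<And>x y. x < y \<Longrightarrow> {x..y} \<subseteq> N \<Longrightarrow> y - x \<le> 1 \<and>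
      (\<exists>t. lift1 t \<and> (\<forall>z. reach Gs z (t z)) \<and> 2 * (y - x) \<le> t y - t x)"
    and U: "open U" "U \<noteq> {}"
  shows "\<exists>u\<in>U. \<exists>z. reach Gs u z \<and> z \<notin> N"
proof -
  have "\<exists>t\<in>{t. lift1 t \<and> (\<forall>z. reach Gs z (t z))}. \<exists>z\<in>U. t z \<notin> N"
  proof (rule expansion_leaves)
    fix s t assume "s \<in> {t. lift1 t \<and> (\<forall>z. reach Gs z (t z))}" "t \<in> {t. lift1 t \<and> (\<forall>z. reach Gs z (t z))}"
    then show "(\<lambda>x. s (t x)) \<in> {t. lift1 t \<and> (\<forall>z. reach Gs z (t z))}"
      using lift1_comp[of s t] reach_trans[OF lifts] by blast
  qed (use expand U in \<open>auto simp: reach_refl lift1_def strict_mono_def\<close>)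
  then show ?thesis by blast
qed

text \<open>Here \<open>T\<close> consists of lifts that move points against the dynamics, such as
  inverses of words. Expanding U by them produces a point outside N whose forward orbit meets
  U.\<close>

lemma expansion_leaves_backward:
  assumes lifts: "\<forall>G\<in>set Gs. lift1 G"
    and expand: "\<And>x y. x < y \<Longrightarrow> {x..y} \<subseteq> N \<Longrightarrow> y - x \<le> 1 \<and>
      (\<exists>t. lift1 t \<and> (\<forall>z. reach Gs (t z) z) \<and> 2 * (y - x) \<le> t y - t x)"
    and U: "open U" "U \<noteq> {}"
  shows "\<exists>u\<in>U. \<exists>z. reach Gs z u \<and> z \<notin> N"
proof -
  have "\<exists>t\<in>{t. lift1 t \<and> (\<forall>z. reach Gs (t z) z)}. \<exists>z\<in>U. t z \<notin> N"
  proof (rule expansion_leaves)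
    fix s t assume "s \<in> {t. lift1 t \<and> (\<forall>z. reach Gs (t z) z)}" "t \<in> {t. lift1 t \<and> (\<forall>z. reach Gs (t z) z)}"
    then show "(\<lambda>x. s (t x)) \<in> {t. lift1 t \<and> (\<forall>z. reach Gs (t z) z)}"
      using lift1_comp[of s t] reach_trans[OF lifts] by blast
  qed (use expand U in \<open>auto simp: reach_refl lift1_def strict_mono_def\<close>)
  then show ?thesis by blast
qed

definition arcs :: "real \<Rightarrow> real \<Rightarrow> real \<Rightarrow> real set" where
  "arcs p lo hi = {z. \<exists>m::int. lo \<le> z - of_int m * p \<and> z - of_int m * p \<le> hi}"

text \<open>The arcs are separated by gaps because hi < lo + p, and an interval that leaves an arc
  has to enter a gap.\<close>

lemma interval_in_one_arc:
  assumes "0 < p" "hi < lo + p" "x \<le> y" "{x..y} \<subseteq> arcs p lo hi"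
  shows "\<exists>m::int. lo \<le> x - of_int m * p \<and> y - of_int m * p \<le> hi"
proof -
  have "x \<in> arcs p lo hi" using assms by auto
  then obtain m :: int where m: "lo \<le> x - of_int m * p" "x - of_int m * p \<le> hi"
    unfolding arcs_def by blast
  have "y - of_int m * p \<le> hi"
  proof (rule ccontr)
    assume y: "\<not> ?thesis"
    \<comment> \<open>The second argument is the midpoint of the gap following the arc; the minimum
      with y keeps z inside the interval.\<close>
    define z where "z = min y (of_int m * p + (hi + lo + p) / 2)"
    have z: "hi < z - of_int m * p" "z - of_int m * p < lo + p" "z \<in> {x..y}"
      using assms m y by (auto simp: z_def min_def field_simps)
    then obtain m' :: int where m': "lo \<le> z - of_int m' * p" "z - of_int m' * p \<le> hi"
      using assms(4) unfolding arcs_def by blast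
    have "(of_int m' - of_int m) * p = (z - of_int m * p) - (z - of_int m' * p)"
      by (simp add: algebra_simps)
    then have "0 < (of_int m' - of_int m) * p" "(of_int m' - of_int m) * p < 1 * p"
      using z m' by linarith+
    then have "(0::real) < of_int m' - of_int m" "(of_int m' - of_int m :: real) < 1"
      using assms(1) by (simp_all add: zero_less_mult_iff)
    then have "0 < m' - m" "m' - m < 1" by linarith+
    then show False by linarith
  qed
  then show ?thesis using m by blast
qed

lemma notin_arcs:
  assumes "0 < p" "z \<notin> arcs p lo hi"
  shows "\<exists>m::int. hi < z - of_int m * p \<and> z - of_int m * p < lo + p"
proof -
  define m where "m = \<lfloor>(z - lo) / p\<rfloor>"
  have "of_int m \<le> (z - lo) / p" "(z - lo) / p < of_int m + 1" unfolding m_def by linarith+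
  then have "lo \<le> z - of_int m * p" "z - of_int m * p < lo + p"
    using assms(1) by (simp_all add: field_simps)
  then show ?thesis using assms(2) unfolding arcs_def by force
qed


subsection \<open>A family with a common fixed point\<close>

text \<open>The lifts below are piecewise affine maps with smoothed corners. A corner is smoothed on its
  right if the slope increases there and on its left otherwise, since \<open>smooth_incr_glue\<close> only passes
  to a larger function.\<close>

lemma ex_contracting_lift:
  assumes d: "3/40 \<le> d" "d \<le> 7/40"
  shows "\<exists>F. (\<forall>r. diff_lift r F) \<and> (\<forall>x. -1/50 \<le> x \<longrightarrow> x \<le> 1/50 \<longrightarrow> F x = 4 * x + 0) \<and>
    (\<forall>x. 23/1000 \<le> x \<longrightarrow> x \<le> 977/1000 \<longrightarrow> F x = 3/4 * x + d)"
proof -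
  \<comment> \<open>The lower bound on d keeps 4 * x below the middle piece up to 23/1000; the upper
    bound keeps the middle piece below 4 * x - 3 from 977/1000 on.\<close>
  obtain P where P: "smooth_incr P" "\<forall>x\<le>1/50. P x = 4 * x + 0" "\<forall>x\<ge>23/1000. P x = 3/4 * x + d"
    using smooth_incr_glue[OF smooth_incr_affine smooth_incr_affine, of 4 "3/4" "1/50" "23/1000" 0 d] d
    by force
  obtain Q where Q: "smooth_incr Q" "\<forall>x\<le>977/1000. Q x = P x" "\<forall>x\<ge>979/1000. Q x = 4 * x + -3"
    using smooth_incr_glue[OF P(1) smooth_incr_affine[of 4 "-3"], of "977/1000" "979/1000"] d P(3)
    by force
  \<comment> \<open>In this window x lies on the first piece of slope 4 and x + 1 on the last one,
    which is its translate.\<close>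
  have "Q (x + 1) = Q x + 1" if "-41/2000 - 1/2000 < x" "x < -41/2000 + 1/2000" for x
    using that P(2) Q(2,3) by simp
  then obtain F where F: "\<forall>r. diff_lift r F"
    "\<forall>x. -41/2000 \<le> x \<longrightarrow> x \<le> -41/2000 + 1 \<longrightarrow> F x = Q x"
    using diff_lift_periodic_extension[OF Q(1), of "1/2000" "-41/2000"] by auto
  have "F x = 4 * x + 0" if "-1/50 \<le> x" "x \<le> 1/50" for x
    using that F(2) P(2) Q(2) by simp
  moreover have "F x = 3/4 * x + d" if "23/1000 \<le> x" "x \<le> 977/1000" for x
    using that F(2) P(3) Q(2) by simp
  ultimately show ?thesis using F(1) by blast
qed

lemma ex_opposite_lift:
  "\<exists>F. (\<forall>r. diff_lift r F) \<and> (\<forall>x. -395/1000 \<le> x \<longrightarrow> x \<le> 395/1000 \<longrightarrow> F x = 1/4 * x + 0)"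
proof -
  \<comment> \<open>The lines of slope 1/4 and 4 cross exactly at 2/5 and, symmetrically, at
    3/5.\<close>
  obtain P where P: "smooth_incr P" "\<forall>x\<le>2/5. P x = 1/4 * x + 0" "\<forall>x\<ge>41/100. P x = 4 * x + -3/2"
    using smooth_incr_glue[OF smooth_incr_affine smooth_incr_affine, of "1/4" 4 "2/5" "41/100" 0 "-3/2"]
    by force
  obtain Q where Q: "smooth_incr Q" "\<forall>x\<le>59/100. Q x = P x" "\<forall>x\<ge>3/5. Q x = 1/4 * x + 3/4"
    using smooth_incr_glue[OF P(1) smooth_incr_affine[of "1/4" "3/4"], of "59/100" "3/5"] P(3)
    by force
  have "Q (x + 1) = Q x + 1" if "-399/1000 - 1/2000 < x" "x < -399/1000 + 1/2000" for x
    using that P(2)[rule_format, of x] Q(2)[rule_format, of x] Q(3)[rule_format, of "x + 1"] by (simp add: field_simps)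
  then obtain F where F: "\<forall>r. diff_lift r F"
    "\<forall>x. -399/1000 \<le> x \<longrightarrow> x \<le> -399/1000 + 1 \<longrightarrow> F x = Q x"
    using diff_lift_periodic_extension[OF Q(1), of "1/2000" "-399/1000"] by auto
  have "F x = 1/4 * x + 0" if "-395/1000 \<le> x" "x \<le> 395/1000" for x
    using that F(2)[rule_format, of x] P(2)[rule_format, of x] Q(2)[rule_format, of x] by simp
  then show ?thesis using F(1) by blast
qed

lemma transitive_near_common_fixed_point:
  assumes lifts: "\<forall>G\<in>set Gs. lift1 G"
    and B: "\<And>x. -1/50 \<le> x \<Longrightarrow> x \<le> 1/50 \<Longrightarrow> B x = 4 * x + 0"
      "\<And>x. 23/1000 \<le> x \<Longrightarrow> x \<le> 977/1000 \<Longrightarrow> B x = 3/4 * x + 3/40"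
    and B': "\<And>x. 23/1000 \<le> x \<Longrightarrow> x \<le> 977/1000 \<Longrightarrow> B' x = 3/4 * x + 7/40"
    and A: "\<And>x. -395/1000 \<le> x \<Longrightarrow> x \<le> 395/1000 \<Longrightarrow> A x = 1/4 * x + 0" "lift1 A"
    and b: "near Gs (1/2000) B b" and b': "near Gs (1/2000) B' b'" and a: "near Gs (1/2000) A a"
  shows "ifs_transitive Gs"
proof (rule transitive_if_dense_orbits)
  define L where "L = {6/100..94/100::real}"
  \<comment> \<open>The set J lies between the attracting fixed points 3/10 of \<open>B\<close> and
    7/10 of \<open>B'\<close>. Its images [36/100, 54/100] and [46/100, 64/100] overlap around 1/2
    and exceed J on both sides.\<close>
  define J where "J = {38/100..62/100::real}"
  fix U :: "real set" assume U: "open U" "U \<noteq> {}"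
  have la: "lift1 a" "lift1 (inv a)" "lift1 b" using a b near_lift1 lift1_inv by blast+
  have "\<exists>u\<in>U. \<exists>z. reach Gs u z \<and> z \<notin> arcs 1 (-1/50) (1/50)"
  proof (rule expansion_leaves_forward[OF lifts _ U])
    fix x y :: real assume xy: "x < y" "{x..y} \<subseteq> arcs 1 (-1/50) (1/50)"
    then obtain m :: int where m: "-1/50 \<le> x - of_int m" "y - of_int m \<le> 1/50"
      using interval_in_one_arc[of 1 "1/50" "-1/50" x y] by auto
    have "(4 - 1/2000) * ((y - of_int m) - (x - of_int m)) \<le> b (y - of_int m) - b (x - of_int m)"
      by (rule near_affine(1)[OF b _ B(1) B(1)]) (use m xy in auto)
    then have "2 * (y - x) \<le> b y - b x" using xy by (simp add: lift1_int_diff[OF la(3)])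
    then show "y - x \<le> 1 \<and> (\<exists>t. lift1 t \<and> (\<forall>z. reach Gs z (t z)) \<and> 2 * (y - x) \<le> t y - t x)"
      using m la(3) near_reach[OF b] by (intro conjI exI[of _ b]) auto
  qed
  then obtain u z where u: "u \<in> U" "reach Gs u z" "z \<notin> arcs 1 (-1/50) (1/50)" by blast
  obtain m :: int where m: "1/50 < z - of_int m" "z - of_int m < -1/50 + 1"
    using notin_arcs[OF _ u(3)] by auto
  \<comment> \<open>By monotonicity it suffices that b sends 1/50 and -1/50 nearly to 4/50 and
    -4/50, which is beyond the margin 6/100 of L.\<close>
  have bz: "b (z - of_int m) \<in> L"
  proof -
    have "b (1/50) \<le> b (z - of_int m)" "b (z - of_int m) \<le> b (-1/50 + 1)"
      using m lift1_le_iff[OF la(3)] by auto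
    moreover have "b (-1/50 + 1) = b (-1/50) + 1" using la(3) unfolding lift1_def by blast
    moreover have "B (1/50) = 4/50" "B (-1/50) = -4/50" using B(1)[of "1/50"] B(1)[of "-1/50"] by auto
    ultimately show ?thesis
      using near_value[OF b, of "1/50"] near_value[OF b, of "-1/50"] unfolding L_def by auto
  qed
  have "reach Gs z (z - of_int m)" using reach_int[of Gs z "- m"] by simp
  then have bo: "b (z - of_int m) \<in> orbit_pt Gs u"
    using reach_orbit_pt[OF lifts reach_trans[OF lifts u(2)] near_orbit[OF b]] by blast
  have "closure (orbit_pt Gs u) = UNIV"
  proof (rule orbit_dense_criterion[where \<Phi> = "{b, b'}" and c = "3/4 + 1/2000" and L = L and J = J and B = 1])
    fix f z assume "f \<in> {b, b'}" then show "f z \<in> orbit_pt Gs z"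
      using near_orbit b b' by blast
  next
    fix f x y assume "f \<in> {b, b'}" "x \<in> L" "y \<in> L"
    then show "\<bar>f x - f y\<bar> \<le> (3/4 + 1/2000) * \<bar>x - y\<bar>"
      using near_contraction[OF b, of L "3/4" "3/40" x y] near_contraction[OF b', of L "3/4" "7/40" x y]
        B(2) B' unfolding L_def by auto
  next
    fix f x assume "f \<in> {b, b'}" "x \<in> L"
    then show "f x \<in> L"
      using near_value[OF b, of x] near_value[OF b', of x] B(2)[of x] B'[of x] unfolding L_def by auto
  next
    fix y assume y: "y \<in> J"
    consider "y \<le> 1/2" | "1/2 \<le> y" by linarith
    then show "\<exists>f\<in>{b, b'}. \<exists>y'\<in>J. f y' = y"
    proof cases
      case 1
      have "inv b y \<in> J"
        using near_preimage[OF b, of "38/100" y "62/100"] y 1 B(2) unfolding J_def by auto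
      then show ?thesis using lift1_f_inv[OF near_lift1[OF b]] by blast
    next
      case 2
      have "inv b' y \<in> J"
        using near_preimage[OF b', of "38/100" y "62/100"] y 2 B' unfolding J_def by auto
      then show ?thesis using lift1_f_inv[OF near_lift1[OF b']] by blast
    qed
  next
    fix V :: "real set" assume V: "open V" "V \<noteq> {}"
    \<comment> \<open>The bound 98/1000 is the end 395/4000 of the affine image of A, less the
      error. Outside these arcs a single \<open>inv a\<close> lands in J, because A maps J onto
      [95/1000, 905/1000].\<close>
    have "\<exists>v\<in>V. \<exists>z. reach Gs z v \<and> z \<notin> arcs 1 (-98/1000) (98/1000)"
    proof (rule expansion_leaves_backward[OF lifts _ V])
      fix x y :: real assume xy: "x < y" "{x..y} \<subseteq> arcs 1 (-98/1000) (98/1000)"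
      then obtain m :: int where m: "-98/1000 \<le> x - of_int m" "y - of_int m \<le> 98/1000"
        using interval_in_one_arc[of 1 "98/1000" "-98/1000" x y] by auto
      have "2 * ((y - of_int m) - (x - of_int m)) \<le> inv a (y - of_int m) - inv a (x - of_int m)"
        by (rule near_inv_expands[OF a, of "-395/1000" "395/1000" "1/4" 0]) (use m xy A(1) A(1)[of "-395/1000"] A(1)[of "395/1000"] in auto)
      then have "2 * (y - x) \<le> inv a y - inv a x" using xy by (simp add: lift1_int_diff[OF la(2)])
      then show "y - x \<le> 1 \<and> (\<exists>t. lift1 t \<and> (\<forall>z. reach Gs (t z) z) \<and> 2 * (y - x) \<le> t y - t x)"
        using m la(2) near_inv_reach[OF lifts a] by (intro conjI exI[of _ "inv a"]) auto
    qed
    then obtain v z where v: "v \<in> V" "reach Gs z v" "z \<notin> arcs 1 (-98/1000) (98/1000)" by blast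
    obtain m :: int where m: "98/1000 < z - of_int m" "z - of_int m < -98/1000 + 1"
      using notin_arcs[OF _ v(3)] by auto
    \<comment> \<open>The point 62/100 lies outside the known affine window of A and is reached from
      -38/100 by periodicity.\<close>
    have "A (-38/100 + 1) = A (-38/100) + 1" using A(2) unfolding lift1_def by blast
    then have "A (62/100) = 905/1000" using A(1)[of "-38/100"] by simp
    then have "inv a (z - of_int m) \<in> J"
      using near_preimage[OF a, of "38/100" "z - of_int m" "62/100"] m A(1)[of "38/100"]
      unfolding J_def by auto
    moreover have "reach Gs (z - of_int m) z" using reach_int[of Gs "z - of_int m" m] by simp
    then have "reach Gs (inv a (z - of_int m)) v"
      using near_inv_reach[OF lifts a] reach_trans[OF lifts] v(2) by blast
    ultimately show "\<exists>y\<in>J. \<exists>v\<in>V. reach Gs y v" using v(1) by blast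
  qed (use lifts bz bo in \<open>auto simp: L_def J_def\<close>)
  then show "\<exists>u\<in>U. closure (orbit_pt Gs u) = UNIV" using u(1) by blast
qed

subsection \<open>A family whose inverses preserve a Cantor set\<close>

text \<open>On the circle the Cantor set meets the three arcs \<open>[m/3, m/3 + 1/9]\<close>. The following map sends
  the arc \<open>[0, 1/9]\<close> onto the convex hull \<open>[1/3, 7/9]\<close> of the two others, and this hull onto
  \<open>[1, 10/9]\<close>.\<close>

lemma ex_swap_lift:
  "\<exists>F. (\<forall>r. diff_lift r F) \<and> (\<forall>x. 7/45 \<le> x \<longrightarrow> x \<le> 43/45 \<longrightarrow> F x = 1/4 * x + 11/12) \<and>
    (\<forall>x. 0 \<le> x \<longrightarrow> x \<le> 1/9 \<longrightarrow> F x = 4 * x + 1/3)"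
proof -
  \<comment> \<open>The numbers 7/45 and 43/45 are the exact crossings of the lines of slope 4 and
    1/4.\<close>
  obtain P where P: "smooth_incr P" "\<forall>x\<le>3/20. P x = 4 * x + 1/3" "\<forall>x\<ge>7/45. P x = 1/4 * x + 11/12"
    using smooth_incr_glue[OF smooth_incr_affine smooth_incr_affine, of 4 "1/4" "3/20" "7/45" "1/3" "11/12"]
    by force
  obtain Q where Q: "smooth_incr Q" "\<forall>x\<le>43/45. Q x = P x" "\<forall>x\<ge>958/1000. Q x = 4 * x + -8/3"
    using smooth_incr_glue[OF P(1) smooth_incr_affine[of 4 "-8/3"], of "43/45" "958/1000"] P(3)
    by force
  have "Q (x + 1) = Q x + 1" if "-1/25 - 1/1000 < x" "x < -1/25 + 1/1000" for x
    using that P(2)[rule_format, of x] Q(2)[rule_format, of x] Q(3)[rule_format, of "x + 1"]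
    by (simp add: field_simps)
  then obtain F where F: "\<forall>r. diff_lift r F" "\<forall>x. -1/25 \<le> x \<longrightarrow> x \<le> -1/25 + 1 \<longrightarrow> F x = Q x"
    using diff_lift_periodic_extension[OF Q(1), of "1/1000" "-1/25"] by auto
  have "F x = 4 * x + 1/3" if "0 \<le> x" "x \<le> 1/9" for x
    using that F(2)[rule_format, of x] P(2)[rule_format, of x] Q(2)[rule_format, of x] by simp
  moreover have "F x = 1/4 * x + 11/12" if "7/45 \<le> x" "x \<le> 43/45" for x
    using that F(2)[rule_format, of x] P(3)[rule_format, of x] Q(2)[rule_format, of x] by simp
  ultimately show ?thesis using F(1) by blast
qed

text \<open>The first and last affine pieces map \<open>[-1/3, -11/36]\<close> onto the arc \<open>[-1/3, -2/9]\<close> and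
  \<open>[1/12, 1/9]\<close> onto the hull \<open>[0, 4/9]\<close> of the two other arcs, so the image of the Cantor set covers
  the Cantor set; everything between these pieces is squeezed into the gap \<open>(-2/9, 0)\<close>.\<close>

lemma ex_cantor_expanding_lift:
  assumes d: "-143/1000 \<le> d" "d \<le> -246/10000"
  shows "\<exists>F. (\<forall>r. diff_lift r F) \<and> (\<forall>x. -1/3 \<le> x \<longrightarrow> x \<le> -11/36 \<longrightarrow> F x = 4 * x + 1) \<and>
    (\<forall>x. -3049/10000 \<le> x \<longrightarrow> x \<le> 832/10000 \<longrightarrow> F x = 1/4 * x + d) \<and>
    (\<forall>x. 1/12 \<le> x \<longrightarrow> x \<le> 1/9 \<longrightarrow> F x = 16 * x + -4/3)"
proof -
  \<comment> \<open>The lower bound on d puts the piece of slope 1/4 above 4 * x + 1 at -3049/10000;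
    the upper bound puts it below 16 * x - 4/3 at 832/10000. Gluing requires both.\<close>
  obtain P1 where P1: "smooth_incr P1" "\<forall>x\<le>-11/36. P1 x = 4 * x + 1"
      "\<forall>x\<ge>-3049/10000. P1 x = 1/4 * x + d"
    using smooth_incr_glue[OF smooth_incr_affine smooth_incr_affine, of 4 "1/4" "-11/36" "-3049/10000" 1 d] d
    by force
  obtain P2 where P2: "smooth_incr P2" "\<forall>x\<le>832/10000. P2 x = P1 x" "\<forall>x\<ge>1/12. P2 x = 16 * x + -4/3"
    using smooth_incr_glue[OF P1(1) smooth_incr_affine[of 16 "-4/3"], of "832/10000" "1/12"] P1(3) d
    by force
  obtain P3 where P3: "smooth_incr P3" "\<forall>x\<le>1/9. P3 x = P2 x" "\<forall>x\<ge>1137/10000. P3 x = 1/4 * x + 11/24"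
    using smooth_incr_glue[OF P2(1) smooth_incr_affine[of "1/4" "11/24"], of "1/9" "1137/10000"] P2(3)
    by force
  obtain Q where Q: "smooth_incr Q" "\<forall>x\<le>656/1000. Q x = P3 x" "\<forall>x\<ge>66/100. Q x = 4 * x + -2"
    using smooth_incr_glue[OF P3(1) smooth_incr_affine[of 4 "-2"], of "656/1000" "66/100"] P3(3)
    by force
  have "Q (x + 1) = Q x + 1" if "-1/3 - 6/1000 < x" "x < -1/3 + 6/1000" for x
    using that P1(2)[rule_format, of x] P2(2)[rule_format, of x] P3(2)[rule_format, of x]
      Q(2)[rule_format, of x] Q(3)[rule_format, of "x + 1"] by simp
  then obtain F where F: "\<forall>r. diff_lift r F" "\<forall>x. -1/3 \<le> x \<longrightarrow> x \<le> -1/3 + 1 \<longrightarrow> F x = Q x"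
    using diff_lift_periodic_extension[OF Q(1), of "6/1000" "-1/3"] by auto
  have "F x = 4 * x + 1" if "-1/3 \<le> x" "x \<le> -11/36" for x
    using that F(2)[rule_format, of x] P1(2)[rule_format, of x] P2(2)[rule_format, of x]
      P3(2)[rule_format, of x] Q(2)[rule_format, of x] by simp
  moreover have "F x = 1/4 * x + d" if "-3049/10000 \<le> x" "x \<le> 832/10000" for x
    using that F(2)[rule_format, of x] P1(3)[rule_format, of x] P2(2)[rule_format, of x]
      P3(2)[rule_format, of x] Q(2)[rule_format, of x] by simp
  moreover have "F x = 16 * x + -4/3" if "1/12 \<le> x" "x \<le> 1/9" for x
    using that F(2)[rule_format, of x] P2(3)[rule_format, of x]
      P3(2)[rule_format, of x] Q(2)[rule_format, of x] by simp
  ultimately show ?thesis using F(1) by blast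
qed

section \<open>Minimality of all families near the Cantor family\<close>

lemma near_rotation_inv:
  assumes n: "near Gs (1/2000) (\<lambda>x. x + a) g"
  shows "z - a - 1/2000 \<le> inv g z \<and> inv g z \<le> z - a + 1/2000"
    and "x \<le> y \<Longrightarrow> 9/10 * (y - x) \<le> inv g y - inv g x"
proof -
  show "z - a - 1/2000 \<le> inv g z \<and> inv g z \<le> z - a + 1/2000"
    using near_value[OF n, of "inv g z"] lift1_f_inv[OF near_lift1[OF n], of z] by linarith
  show "9/10 * (y - x) \<le> inv g y - inv g x" if "x \<le> y"
    by (rule near_inv_expands[OF n, of "x - a - 1" "y - a + 1" 1 a]) (use that in auto)
qed

text \<open>Whatever m is, one rotation at most and an exact integer shift are used, so the error
  does not grow with m.\<close>

lemma backward_rotation: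
  fixes m :: int
  assumes lifts: "\<forall>G\<in>set Gs. lift1 G"
    and r1: "near Gs (1/2000) (\<lambda>x. x + 1/3) r1" and r2: "near Gs (1/2000) (\<lambda>x. x + 2/3) r2"
  shows "\<exists>\<rho>. lift1 \<rho> \<and> (\<forall>z. reach Gs (\<rho> z) z) \<and>
    (\<forall>z. z - of_int m * (1/3) - 1/2000 \<le> \<rho> z \<and> \<rho> z \<le> z - of_int m * (1/3) + 1/2000) \<and>
    (\<forall>x y. x \<le> y \<longrightarrow> 9/10 * (y - x) \<le> \<rho> y - \<rho> x)"
proof -
  define q where "q = m div 3"
  have shift: "lift1 (\<lambda>z. z - of_int q)"
    by (auto simp: lift1_def strict_mono_def intro!: continuous_intros)
  have unshift: "reach Gs (z - of_int q) z" for z using reach_int[of Gs "z - of_int q" q] by simp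
  consider "m = 3 * q" | "m = 3 * q + 1" | "m = 3 * q + 2" unfolding q_def by linarith
  then show ?thesis
  proof cases
    case 1
    show ?thesis
      by (rule exI[of _ "\<lambda>z. z - of_int q"]) (use shift unshift 1 in auto)
  next
    case 2
    have "z - of_int m * (1/3) - 1/2000 \<le> inv r1 (z - of_int q) \<and>
        inv r1 (z - of_int q) \<le> z - of_int m * (1/3) + 1/2000" for z
      using near_rotation_inv(1)[OF r1, of "z - of_int q"] 2 by (simp add: algebra_simps)
    moreover have "9/10 * (y - x) \<le> inv r1 (y - of_int q) - inv r1 (x - of_int q)" if "x \<le> y" for x y
      using near_rotation_inv(2)[OF r1, of "x - of_int q" "y - of_int q"] that by simp
    moreover have "reach Gs (inv r1 (z - of_int q)) z" for z
      using reach_trans[OF lifts near_inv_reach[OF lifts r1] unshift] .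
    ultimately show ?thesis
      using lift1_comp[OF lift1_inv[OF near_lift1[OF r1]] shift]
      by (intro exI[of _ "\<lambda>z. inv r1 (z - of_int q)"]) auto
  next
    case 3
    have "z - of_int m * (1/3) - 1/2000 \<le> inv r2 (z - of_int q) \<and>
        inv r2 (z - of_int q) \<le> z - of_int m * (1/3) + 1/2000" for z
      using near_rotation_inv(1)[OF r2, of "z - of_int q"] 3 by (simp add: algebra_simps)
    moreover have "9/10 * (y - x) \<le> inv r2 (y - of_int q) - inv r2 (x - of_int q)" if "x \<le> y" for x y
      using near_rotation_inv(2)[OF r2, of "x - of_int q" "y - of_int q"] that by simp
    moreover have "reach Gs (inv r2 (z - of_int q)) z" for z
      using reach_trans[OF lifts near_inv_reach[OF lifts r2] unshift] .
    ultimately show ?thesis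
      using lift1_comp[OF lift1_inv[OF near_lift1[OF r2]] shift]
      by (intro exI[of _ "\<lambda>z. inv r2 (z - of_int q)"]) auto
  qed
qed

text \<open>Forward words only add 1/3 or 2/3, so rotations by -1/3 and -2/3 are realised as 2/3 - 1
  and 1/3 - 1.\<close>

lemma forward_rotation:
  fixes m :: int
  assumes lifts: "\<forall>G\<in>set Gs. lift1 G"
    and r1: "near Gs (1/2000) (\<lambda>x. x + 1/3) r1" and r2: "near Gs (1/2000) (\<lambda>x. x + 2/3) r2"
  shows "\<exists>w. reach Gs x w \<and> x - of_int m * (1/3) - 1/2000 \<le> w \<and> w \<le> x - of_int m * (1/3) + 1/2000"
proof -
  define q where "q = m div 3"
  have int: "reach Gs z (z - of_int q)" for z q using reach_int[of Gs z "- q"] by simp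
  have r: "reach Gs x (r (x - of_int q) - of_int 1)" if "near Gs (1/2000) R r" for r R
    using reach_trans[OF lifts reach_trans[OF lifts int[of x q] near_reach[OF that]] int] .
  consider "m = 3 * q" | "m = 3 * q + 1" | "m = 3 * q + 2" unfolding q_def by linarith
  then show ?thesis
  proof cases
    case 1
    then show ?thesis using int[of x q] by (intro exI[of _ "x - of_int q"]) auto
  next
    case 2
    then show ?thesis using r[OF r2] near_value[OF r2, of "x - of_int q"]
      by (intro exI[of _ "r2 (x - of_int q) - of_int 1"]) (auto simp: field_simps)
  next
    case 3
    then show ?thesis using r[OF r1] near_value[OF r1, of "x - of_int q"]
      by (intro exI[of _ "r1 (x - of_int q) - of_int 1"]) (auto simp: field_simps)
  qed
qed

text \<open>Being valid for every nearby family, this yields minimality of the constructed family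
  and, since minimality implies transitivity, its robust transitivity.\<close>

lemma minimal_near_cantor_family:
  assumes lifts: "\<forall>G\<in>set Gs. lift1 G"
    and F: "\<And>i x. i < 5 \<Longrightarrow> -3049/10000 \<le> x \<Longrightarrow> x \<le> 832/10000 \<Longrightarrow>
      F i x = 1/4 * x + (-143/1000 + real i * (296/10000))"
    and S: "\<And>x. 7/45 \<le> x \<Longrightarrow> x \<le> 43/45 \<Longrightarrow> S x = 1/4 * x + 11/12"
    and f: "\<And>i. i < 5 \<Longrightarrow> near Gs (1/2000) (F i) (f i)"
    and s: "near Gs (1/2000) S s"
    and r1: "near Gs (1/2000) (\<lambda>x. x + 1/3) r1" and r2: "near Gs (1/2000) (\<lambda>x. x + 2/3) r2"
  shows "ifs_minimal Gs"
  unfolding ifs_minimal_def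
proof
  fix x
  define L where "L = {-1/5..-1/50::real}"
  define J where "J = {-189/1000..-34/1000::real}"
  have enter: "\<exists>x0\<in>L. x0 \<in> orbit_pt Gs x" if w: "reach Gs x w" "-23/100 \<le> w" "w \<le> 1/20" for w
  proof (rule bexI[of _ "f 2 w"])
    show "f 2 w \<in> orbit_pt Gs x" using reach_orbit_pt[OF lifts w(1) near_orbit[OF f]] by simp
    show "f 2 w \<in> L" using near_value[OF f, of 2 w] F[of 2 w] w unfolding L_def by simp
  qed
  have "\<exists>x0\<in>L. x0 \<in> orbit_pt Gs x"
  proof -
    \<comment> \<open>With this m the point x - m/3 lies in [-2/9, 1/9), the gap containing the
      blender followed by one arc.\<close>
    define m where "m = \<lfloor>3 * (x + 2/9)\<rfloor>"
    have m: "of_int m \<le> 3 * (x + 2/9)" "3 * (x + 2/9) < of_int m + 1" unfolding m_def by linarith+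
    obtain w where w: "reach Gs x w" "x - of_int m * (1/3) - 1/2000 \<le> w"
      "w \<le> x - of_int m * (1/3) + 1/2000"
      using forward_rotation[OF lifts r1 r2] by blast
    have wb: "-2/9 - 1/2000 \<le> w" "w \<le> 1/9 + 1/2000" using w(2,3) m by (auto simp: field_simps)
    show ?thesis
    proof (cases "w \<le> 1/20")
      case True
      show ?thesis by (rule enter[OF w(1)]) (use wb True in linarith)+
    next
      case False
      \<comment> \<open>The piece of slope 1/4 of the \<open>F i\<close> ends before 1/9, so points
        near the right end of the arc need a detour: the exchange takes the rotated point to between
        1/100 and 3/100 modulo 1.\<close>
      have v: "38/100 \<le> r1 w" "r1 w \<le> 45/100" using near_value[OF r1, of w] False wb by linarith+
      have "reach Gs (s (r1 w)) (s (r1 w) - 1)" using reach_int[of Gs "s (r1 w)" "-1"] by simp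
      then have "reach Gs x (s (r1 w) - 1)"
        using reach_trans[OF lifts w(1)] reach_trans[OF lifts near_reach[OF r1]]
          reach_trans[OF lifts near_reach[OF s]] by blast
      then show ?thesis
        by (rule enter) (use v near_value[OF s, of "r1 w"] S[of "r1 w"] in linarith)+
    qed
  qed
  then obtain x0 where x0: "x0 \<in> L" "x0 \<in> orbit_pt Gs x" by blast
  show "closure (orbit_pt Gs x) = UNIV"
  proof (rule orbit_dense_criterion[where \<Phi> = "f ` {..<5}" and c = "1/4 + 1/2000" and L = L and J = J and B = 1])
    fix g z assume "g \<in> f ` {..<5}" then show "g z \<in> orbit_pt Gs z"
      using near_orbit[OF f] by auto
  next
    fix g x y assume "g \<in> f ` {..<5}" "x \<in> L" "y \<in> L"
    then obtain i where i: "i < 5" "g = f i" "x \<in> L" "y \<in> L" by auto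
    have "F i z = 1/4 * z + (-143/1000 + real i * (296/10000))" if "z \<in> L" for z
      using that by (intro F i) (auto simp: L_def)
    then show "\<bar>g x - g y\<bar> \<le> (1/4 + 1/2000) * \<bar>x - y\<bar>"
      using near_contraction[OF f[OF i(1)]] i by blast
  next
    fix g x assume "g \<in> f ` {..<5}" "x \<in> L"
    then obtain i where i: "i < 5" "g = f i" "x \<in> L" by auto
    have "0 \<le> real i" "real i \<le> 4" using i by auto
    moreover have "F i x = 1/4 * x + (-143/1000 + real i * (296/10000))"
      using i by (intro F i) (auto simp: L_def)
    ultimately show "g x \<in> L"
      using near_value[OF f[OF i(1)], of x] i unfolding L_def by auto
  next
    fix y assume y: "y \<in> J"
    have *: "\<exists>g\<in>f ` {..<5}. \<exists>y'\<in>J. g y' = y"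
      \<comment> \<open>These bounds describe the image of J under \<open>F i\<close>, shortened by
        1/2000 at both ends. Consecutive images are shifted by 296/10000, less than their length
        3875/100000.\<close>
      if i: "i < 5" and b: "-143/1000 + real i * (296/10000) - 4675/100000 \<le> y"
        "y \<le> -143/1000 + real i * (296/10000) - 9/1000" for i
    proof -
      have "-189/1000 \<le> inv (f i) y" "inv (f i) y \<le> -34/1000"
        using F[OF i, of "-189/1000"] F[OF i, of "-34/1000"] b
          near_preimage[OF f[OF i], of "-189/1000" y "-34/1000"] by auto
      then show ?thesis using lift1_f_inv[OF near_lift1[OF f[OF i]], of y] i
        by (intro bexI[of _ "f i"] bexI[of _ "inv (f i) y"]) (auto simp: J_def)
    qed
    consider "y \<le> -153/1000" | "-153/1000 \<le> y" "y \<le> -123/1000" | "-123/1000 \<le> y" "y \<le> -93/1000"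
      | "-93/1000 \<le> y" "y \<le> -64/1000" | "-64/1000 \<le> y" by linarith
    then show "\<exists>g\<in>f ` {..<5}. \<exists>y'\<in>J. g y' = y"
    proof cases
      case 1 then show ?thesis using *[of 0] y by (simp add: J_def)
    next
      case 2 then show ?thesis using *[of 1] by simp
    next
      case 3 then show ?thesis using *[of 2] by simp
    next
      case 4 then show ?thesis using *[of 3] by simp
    next
      case 5 then show ?thesis using *[of 4] y by (simp add: J_def)
    qed
  next
    fix V :: "real set" assume V: "open V" "V \<noteq> {}"
    \<comment> \<open>Modulo 1, S maps its contracting piece onto [-2/45, 7/45]. These arcs stay
      inside with a margin for the errors of rotation and exchange, yet are wide enough that the
      remaining gaps rotate into J.\<close>
    let ?N = "arcs (1/3) (-37/1000) (148/1000)"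
    have "\<exists>v\<in>V. \<exists>z. reach Gs z v \<and> z \<notin> ?N"
    proof (rule expansion_leaves_backward[OF lifts _ V])
      fix x y :: real assume xy: "x < y" "{x..y} \<subseteq> ?N"
      then obtain m :: int where m: "-37/1000 \<le> x - of_int m * (1/3)" "y - of_int m * (1/3) \<le> 148/1000"
        using interval_in_one_arc[of "1/3" "148/1000" "-37/1000" x y] by auto
      obtain \<rho> where \<rho>: "lift1 \<rho>" "\<And>z. reach Gs (\<rho> z) z"
        "\<And>z. z - of_int m * (1/3) - 1/2000 \<le> \<rho> z \<and> \<rho> z \<le> z - of_int m * (1/3) + 1/2000"
        "\<And>x y. x \<le> y \<Longrightarrow> 9/10 * (y - x) \<le> \<rho> y - \<rho> x"
        using backward_rotation[OF lifts r1 r2, of m] by blast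
      have ls: "lift1 (inv s)" using lift1_inv[OF near_lift1[OF s]] .
      \<comment> \<open>The factor 3 leaves room for the loss 9/10 in the rotation: 27/10 is still
        at least 2.\<close>
      have "3 * ((\<rho> y + of_int 1) - (\<rho> x + of_int 1)) \<le> inv s (\<rho> y + of_int 1) - inv s (\<rho> x + of_int 1)"
      proof (rule near_inv_expands[OF s, of "7/45" "43/45" "1/4" "11/12"])
        show "\<rho> x + of_int 1 \<le> \<rho> y + of_int 1" using lift1_le_iff[OF \<rho>(1)] xy by simp
        show "S (7/45) + 1/2000 \<le> \<rho> x + of_int 1" "\<rho> y + of_int 1 \<le> S (43/45) - 1/2000"
          using S[of "7/45"] S[of "43/45"] \<rho>(3)[of x] \<rho>(3)[of y] m by auto
      qed (use S in auto)
      then have "2 * (y - x) \<le> inv s (\<rho> y) - inv s (\<rho> x)"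
        using \<rho>(4)[of x y] xy by (simp add: lift1_int[OF ls, of _ 1, simplified])
      then show "y - x \<le> 1 \<and> (\<exists>t. lift1 t \<and> (\<forall>z. reach Gs (t z) z) \<and> 2 * (y - x) \<le> t y - t x)"
        using m lift1_comp[OF ls \<rho>(1)] reach_trans[OF lifts near_inv_reach[OF lifts s] \<rho>(2)]
        by (intro conjI exI[of _ "\<lambda>z. inv s (\<rho> z)"]) auto
    qed
    then obtain v z where v: "v \<in> V" "reach Gs z v" "z \<notin> ?N" by blast
    obtain m :: int where m: "148/1000 < z - of_int m * (1/3)" "z - of_int m * (1/3) < -37/1000 + 1/3"
      using notin_arcs[OF _ v(3)] by auto
    \<comment> \<open>J lies to the left of 0, whereas the gap found follows the arc with index m;
      hence the rotation by m + 1 thirds.\<close>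
    obtain \<rho> where \<rho>: "\<And>z. reach Gs (\<rho> z) z" "\<And>z. z - of_int (m + 1) * (1/3) - 1/2000 \<le> \<rho> z \<and>
        \<rho> z \<le> z - of_int (m + 1) * (1/3) + 1/2000"
      using backward_rotation[OF lifts r1 r2, of "m + 1"] by blast
    have "\<rho> z \<in> J" using \<rho>(2)[of z] m by (auto simp: J_def field_simps)
    then show "\<exists>y\<in>J. \<exists>v\<in>V. reach Gs y v" using reach_trans[OF lifts \<rho>(1) v(2)] v(1) by blast
  qed (use lifts x0 in \<open>auto simp: L_def J_def\<close>)
qed

section \<open>Invariant sets as obstructions to minimality\<close>

lemma not_minimal_if_invariant:
  assumes x: "x \<in> X" and G: "\<And>G z. G \<in> set Gs \<Longrightarrow> z \<in> X \<Longrightarrow> G z \<in> X"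
    and int: "\<And>z n. z \<in> X \<Longrightarrow> z + of_int n \<in> X"
    and V: "open V" "v \<in> V" "V \<inter> X = {}"
  shows "\<not> ifs_minimal Gs"
proof
  assume "ifs_minimal Gs"
  then have "v \<in> closure (orbit_pt Gs x)" by (simp add: ifs_minimal_def)
  then obtain y where y: "y \<in> V" "y \<in> orbit_pt Gs x" using V closure_iff_nhds_not_empty by blast
  have "foldr (\<circ>) ws id x \<in> X" if "set ws \<subseteq> set Gs" for ws
    using that by (induction ws) (auto simp: x G)
  then have "y \<in> X" using y(2) int by (auto simp: orbit_pt_iff)
  then show False using y V by blast
qed

text \<open>Up to integers, \<open>3 * x\<close> has a base 4 expansion with digits 0 and 1 only.\<close>

definition cantor :: "real set" where
  "cantor = {x. \<forall>n::nat. frac (4 ^ n * (3 * x)) \<le> 1/3}"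

text \<open>Multiplication by 4 shifts the base 4 expansion, so the first condition splits off and
  the others say that the shifted point qualifies.\<close>

lemma cantor_iff: "x \<in> cantor \<longleftrightarrow> frac (3 * x) \<le> 1/3 \<and> 4 * x \<in> cantor"
proof -
  have "(\<forall>n::nat. frac (4 ^ n * (3 * x)) \<le> 1/3) \<longleftrightarrow>
      frac (4 ^ 0 * (3 * x)) \<le> 1/3 \<and> (\<forall>n::nat. frac (4 ^ Suc n * (3 * x)) \<le> 1/3)"
    by (metis not0_implies_Suc)
  then show ?thesis by (simp add: cantor_def mult.assoc mult.left_commute)
qed

lemma cantor_add_third: "x \<in> cantor \<Longrightarrow> x + of_int m / 3 \<in> cantor"
proof -
  have "frac (4 ^ n * (3 * (x + of_int m / 3))) = frac (4 ^ n * (3 * x))" for n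
  proof -
    have "4 ^ n * (3 * (x + of_int m / 3)) = 4 ^ n * (3 * x) + of_int (4 ^ n * m)"
      by (simp add: algebra_simps)
    then show ?thesis by (simp only: frac_def floor_add_int[symmetric] of_int_add)
  qed
  then show "x \<in> cantor \<Longrightarrow> x + of_int m / 3 \<in> cantor" by (simp add: cantor_def)
qed

text \<open>For y between 0 and 4/9 the number 3 * y / 4 lies in [0, 1/3], so the one new condition
  of \<open>cantor_iff\<close> holds.\<close>

lemma cantor_quarter:
  assumes "y \<in> cantor" "0 \<le> y" "y \<le> 4/9" shows "y / 4 \<in> cantor"
proof -
  have "\<lfloor>3 * (y / 4)\<rfloor> = 0" using assms by (simp add: floor_eq_iff)
  then show ?thesis using assms by (subst cantor_iff) (simp add: frac_def)
qed

lemma cantor_cases: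
  assumes "y \<in> cantor"
  shows "\<exists>q::int. y - of_int q \<in> cantor \<and> (0 \<le> y - of_int q \<and> y - of_int q \<le> 1/9 \<or>
    1/3 \<le> y - of_int q \<and> y - of_int q \<le> 4/9 \<or> 2/3 \<le> y - of_int q \<and> y - of_int q \<le> 7/9)"
proof -
  define m where "m = \<lfloor>3 * y\<rfloor>"
  define q where "q = m div 3"
  have "frac (3 * y) \<le> 1/3" using assms cantor_iff by blast
  then have m: "of_int m \<le> 3 * y" "3 * y \<le> of_int m + 1/3" unfolding m_def frac_def by linarith+
  have "y - of_int q \<in> cantor" using cantor_add_third[OF assms, of "- 3 * q"] by simp
  moreover have "m = 3 * q \<or> m = 3 * q + 1 \<or> m = 3 * q + 2" unfolding q_def by linarith
  then have "0 \<le> y - of_int q \<and> y - of_int q \<le> 1/9 \<or>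
    1/3 \<le> y - of_int q \<and> y - of_int q \<le> 4/9 \<or> 2/3 \<le> y - of_int q \<and> y - of_int q \<le> 7/9"
    using m by (elim disjE) simp_all
  ultimately show ?thesis by blast
qed

lemma inv_mem_cantor:
  assumes "lift1 g" "g x = y - of_int q" "x \<in> cantor"
  shows "inv g y \<in> cantor"
proof -
  have "g (x + of_int q) = y" using assms(2) lift1_int[OF assms(1), of x q] by simp
  then have "inv g y = x + of_int (3 * q) / 3" using lift1_inv_f[OF assms(1)] by auto
  then show ?thesis using cantor_add_third[OF assms(3)] by metis
qed

text \<open>Up to integers the inverse is 4 * w + 1/3 on [0, 1/9] and (w - 1/3) / 4 on [1/3, 7/9].
  Both are digit shifts combined with translations by thirds.\<close>

lemma swap_inv_cantor:
  assumes lift: "lift1 S" and S: "\<And>x. 7/45 \<le> x \<Longrightarrow> x \<le> 43/45 \<Longrightarrow> S x = 1/4 * x + 11/12"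
    "\<And>x. 0 \<le> x \<Longrightarrow> x \<le> 1/9 \<Longrightarrow> S x = 4 * x + 1/3" and y: "y \<in> cantor"
  shows "inv S y \<in> cantor"
proof -
  obtain q :: int where q: "y - of_int q \<in> cantor" "0 \<le> y - of_int q \<and> y - of_int q \<le> 1/9 \<or>
    1/3 \<le> y - of_int q \<and> y - of_int q \<le> 4/9 \<or> 2/3 \<le> y - of_int q \<and> y - of_int q \<le> 7/9"
    using cantor_cases[OF y] by blast
  define w where "w = y - of_int q"
  show ?thesis
  proof (cases "w \<le> 1/9")
    case True
    have w: "w \<in> cantor" "0 \<le> w" "w \<le> 1/9" using True q by (auto simp: w_def)
    have "4 * w + of_int 1 / 3 \<in> cantor" using cantor_iff[of w] w cantor_add_third by blast
    \<comment> \<open>The index is q - 1 because S maps the hull [1/3, 7/9] onto [1, 10/9], so the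
      value is w + 1.\<close>
    moreover have "S (4 * w + of_int 1 / 3) = y - of_int (q - 1)"
      using S(1)[of "4 * w + 1/3"] w by (simp add: w_def field_simps)
    ultimately show ?thesis using inv_mem_cantor[OF lift] by blast
  next
    case False
    have w: "w + of_int (-1) / 3 \<in> cantor" "1/3 \<le> w" "w \<le> 7/9"
      using False q cantor_add_third[OF q(1), of "-1"] by (auto simp: w_def)
    have "(w + of_int (-1) / 3) / 4 \<in> cantor" by (rule cantor_quarter) (use w in auto)
    moreover have "S ((w + of_int (-1) / 3) / 4) = y - of_int q"
      using S(2)[of "(w - 1/3) / 4"] w by (simp add: w_def field_simps)
    ultimately show ?thesis using inv_mem_cantor[OF lift] by blast
  qed
qed

text \<open>On [0, 4/9] the inverse divides by 4 twice with a translation by 1/3 in between, and on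
  the third arc it divides once; \<open>cantor_quarter\<close> applies at each division.\<close>

lemma expanding_inv_cantor:
  assumes lift: "lift1 F" and F: "\<And>x. -1/3 \<le> x \<Longrightarrow> x \<le> -11/36 \<Longrightarrow> F x = 4 * x + 1"
    "\<And>x. 1/12 \<le> x \<Longrightarrow> x \<le> 1/9 \<Longrightarrow> F x = 16 * x + -4/3" and y: "y \<in> cantor"
  shows "inv F y \<in> cantor"
proof -
  obtain q :: int where q: "y - of_int q \<in> cantor" "0 \<le> y - of_int q \<and> y - of_int q \<le> 1/9 \<or>
    1/3 \<le> y - of_int q \<and> y - of_int q \<le> 4/9 \<or> 2/3 \<le> y - of_int q \<and> y - of_int q \<le> 7/9"
    using cantor_cases[OF y] by blast
  define w where "w = y - of_int q"
  show ?thesis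
  proof (cases "w \<le> 4/9")
    case True
    have w: "w \<in> cantor" "0 \<le> w" using True q by (auto simp: w_def)
    have "w / 4 + of_int 1 / 3 \<in> cantor" by (intro cantor_add_third cantor_quarter w True)
    then have "(w / 4 + of_int 1 / 3) / 4 \<in> cantor" by (rule cantor_quarter) (use w True in auto)
    moreover have "F ((w / 4 + of_int 1 / 3) / 4) = y - of_int q"
      using F(2)[of "(w / 4 + of_int 1 / 3) / 4"] w True by (simp add: w_def field_simps)
    ultimately show ?thesis using inv_mem_cantor[OF lift] by blast
  next
    case False
    have w: "w + of_int (-2) / 3 \<in> cantor" "2/3 \<le> w" "w \<le> 7/9"
      using False q cantor_add_third[OF q(1), of "-2"] by (auto simp: w_def)
    have "(w + of_int (-2) / 3) / 4 \<in> cantor" by (rule cantor_quarter) (use w in auto)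
    then have "(w + of_int (-2) / 3) / 4 + of_int (-1) / 3 \<in> cantor" by (rule cantor_add_third)
    moreover have "F ((w + of_int (-2) / 3) / 4 + of_int (-1) / 3) = y - of_int (q + 1)"
      using F(1)[of "(w + of_int (-2) / 3) / 4 + of_int (-1) / 3"] w by (simp add: w_def field_simps)
    ultimately show ?thesis using inv_mem_cantor[OF lift] by blast
  qed
qed

lemma rotation_inv_cantor:
  assumes "y \<in> cantor" shows "inv (\<lambda>x. x + of_int m / 3) y \<in> cantor"
proof -
  have "inv (\<lambda>x. x + of_int m / 3) y = y + of_int (- m) / 3"
    by (intro inv_f_eq) (auto simp: inj_def)
  then show ?thesis using cantor_add_third[OF assms] by metis
qed

lemma not_minimal_cantor:
  assumes "\<And>G z. G \<in> set Gs \<Longrightarrow> z \<in> cantor \<Longrightarrow> G z \<in> cantor"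
  shows "\<not> ifs_minimal Gs"
proof (rule not_minimal_if_invariant)
  show "0 \<in> cantor" by (simp add: cantor_def frac_def)
  show "z + of_int n \<in> cantor" if "z \<in> cantor" for z n
    using cantor_add_third[OF that, of "3 * n"] by simp
  show "{1/9<..<1/3} \<inter> cantor = {}"
  proof -
    have "x \<notin> cantor" if "1/9 < x" "x < 1/3" for x
    proof -
      have "\<lfloor>3 * x\<rfloor> = 0" using that by (simp add: floor_eq_iff)
      then have "\<not> frac (3 * x) \<le> 1/3" using that by (simp add: frac_def)
      then show ?thesis by (subst cantor_iff) blast
    qed
    then show ?thesis by auto
  qed
  show "1/6 \<in> {1/9<..<1/3::real}" by simp
qed (use assms in auto)

lemma not_minimal_fixed_point:
  assumes "\<And>G. G \<in> set Gs \<Longrightarrow> lift1 G \<and> G 0 = 0"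
  shows "\<not> ifs_minimal Gs"
proof (rule not_minimal_if_invariant)
  show "(0::real) \<in> range of_int" by (metis of_int_0 rangeI)
  show "G z \<in> range of_int" if "G \<in> set Gs" "z \<in> range of_int" for G z
    using assms[OF that(1)] that(2) lift1_int[of G 0] by auto
  show "z + of_int n \<in> range of_int" if "z \<in> range of_int" for z :: real and n
    using that by (metis imageE of_int_add rangeI)
  show "{0<..<1::real} \<inter> range of_int = {}" by auto
  show "1/2 \<in> {0<..<1::real}" by simp
qed simp

lemma diff_lift_rotation: "diff_lift r (\<lambda>x. x + c)"
  using smooth_incr_affine[of 1 c] smooth_imp_Cr[of "\<lambda>x. x + c" r]
  by (simp add: diff_lift_def smooth_incr_def)

theorem theoremF:
  fixes r :: enat and k :: nat
  assumes "1 \<le> r" and "k \<ge> 8"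
  shows "(\<exists>Fs. RT r (k + 1) Fs \<and> ifs_minimal Fs \<and> \<not> ifs_minimal (inv_fam Fs)) \<and>
         (\<exists>Gs. RT r k Gs \<and> \<not> ifs_minimal Gs \<and> \<not> ifs_minimal (inv_fam Gs))"
proof
  note lift = diff_lift_lift1[OF assms(1)]
  let ?d = "\<lambda>i::nat. -143/1000 + real i * (296/10000)"
  have "\<forall>i. \<exists>F. i < 5 \<longrightarrow> (\<forall>r. diff_lift r F) \<and>
    (\<forall>x. -1/3 \<le> x \<longrightarrow> x \<le> -11/36 \<longrightarrow> F x = 4 * x + 1) \<and>
    (\<forall>x. -3049/10000 \<le> x \<longrightarrow> x \<le> 832/10000 \<longrightarrow> F x = 1/4 * x + ?d i) \<and>
    (\<forall>x. 1/12 \<le> x \<longrightarrow> x \<le> 1/9 \<longrightarrow> F x = 16 * x + -4/3)" (is "\<forall>i. \<exists>F. ?P i F")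
  proof
    fix i :: nat
    show "\<exists>F. ?P i F"
    proof (cases "i < 5")
      case True
      have "-143/1000 \<le> ?d i" "?d i \<le> -246/10000" using True by auto
      from ex_cantor_expanding_lift[OF this] show ?thesis by blast
    qed simp
  qed
  then obtain F where "\<forall>i. ?P i (F i)" by (rule choice[THEN exE])
  then have F: "\<And>i r. i < 5 \<Longrightarrow> diff_lift r (F i)"
    "\<And>i x. i < 5 \<Longrightarrow> -1/3 \<le> x \<Longrightarrow> x \<le> -11/36 \<Longrightarrow> F i x = 4 * x + 1"
    "\<And>i x. i < 5 \<Longrightarrow> -3049/10000 \<le> x \<Longrightarrow> x \<le> 832/10000 \<Longrightarrow> F i x = 1/4 * x + ?d i"
    "\<And>i x. i < 5 \<Longrightarrow> 1/12 \<le> x \<Longrightarrow> x \<le> 1/9 \<Longrightarrow> F i x = 16 * x + -4/3"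
    by blast+
  obtain S where S: "\<And>r. diff_lift r S" "\<And>x. 7/45 \<le> x \<Longrightarrow> x \<le> 43/45 \<Longrightarrow> S x = 1/4 * x + 11/12"
    "\<And>x. 0 \<le> x \<Longrightarrow> x \<le> 1/9 \<Longrightarrow> S x = 4 * x + 1/3"
    using ex_swap_lift by blast
  define R where "R = (\<lambda>m::int. \<lambda>x::real. x + of_int m / 3)"
  have R: "diff_lift r (R m)" for r m unfolding R_def by (rule diff_lift_rotation)
  have R12: "R 1 = (\<lambda>x. x + 1/3)" "R 2 = (\<lambda>x. x + 2/3)" by (auto simp: R_def)
  \<comment> \<open>Since k is at least 8, the length is 5 + 3 + (k - 7) = k + 1. Repeating a member
    does not change the generated semigroup.\<close>
  define Fs where "Fs = map F [0..<5] @ [S, R 1, R 2] @ replicate (k - 7) S"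
  have set_Fs: "set Fs = F ` {..<5} \<union> {S, R 1, R 2}" by (auto simp: Fs_def)
  have IFS: "IFS r (k + 1) Fs"
    unfolding IFS_def set_Fs using assms(2) F(1) S(1) R by (auto simp: Fs_def)
  then have lifts: "\<forall>G\<in>set Fs. lift1 G" using lift by (auto simp: IFS_def)
  \<comment> \<open>Stated for arbitrary nearby \<open>Gs\<close>, to be applied both to the
    perturbations and, by \<open>near_refl\<close>, to \<open>Fs\<close> itself.\<close>
  have minimal: "ifs_minimal Gs"
    if Gs: "\<forall>G\<in>set Gs. lift1 G" "\<forall>G\<in>set Fs. \<exists>g. near Gs (1/2000) G g" for Gs
  proof -
    have "\<forall>i. \<exists>g. i < 5 \<longrightarrow> near Gs (1/2000) (F i) g" using Gs(2) unfolding set_Fs by blast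
    then obtain f where "\<forall>i. i < 5 \<longrightarrow> near Gs (1/2000) (F i) (f i)" by (rule choice[THEN exE])
    then have f: "\<And>i. i < 5 \<Longrightarrow> near Gs (1/2000) (F i) (f i)" by blast
    obtain s r1 r2 where "near Gs (1/2000) S s" "near Gs (1/2000) (R 1) r1" "near Gs (1/2000) (R 2) r2"
      using Gs(2) unfolding set_Fs by blast
    then show ?thesis
      unfolding R12 by (intro minimal_near_cantor_family[OF Gs(1) F(3) S(2) f])
  qed
  have "RT r (k + 1) Fs"
    by (rule RT_if_near_transitive[OF assms(1) IFS, of "1/2000"])
      (auto intro: minimal minimal_imp_transitive)
  moreover have "ifs_minimal Fs"
    by (rule minimal[OF lifts]) (use near_refl[of "1/2000"] lifts in auto)
  moreover have "\<not> ifs_minimal (inv_fam Fs)"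
  proof (rule not_minimal_cantor)
    fix G z assume G: "G \<in> set (inv_fam Fs)" and z: "z \<in> cantor"
    then consider i where "i < 5" "G = inv (F i)" | "G = inv S" | m where "G = inv (R m)"
      by (auto simp: inv_fam_def set_Fs)
    then show "G z \<in> cantor"
    proof cases
      case 1
      show ?thesis
        unfolding 1(2) by (rule expanding_inv_cantor[OF lift[OF F(1)[OF 1(1)]] _ _ z]) (use F 1 in auto)
    next
      case 2
      show ?thesis unfolding 2 by (rule swap_inv_cantor[OF lift[OF S(1)] S(2,3) z])
    next
      case 3
      show ?thesis unfolding 3 R_def by (rule rotation_inv_cantor[OF z])
    qed
  qed
  ultimately show "\<exists>Fs. RT r (k + 1) Fs \<and> ifs_minimal Fs \<and> \<not> ifs_minimal (inv_fam Fs)" by blast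
next
  note lift = diff_lift_lift1[OF assms(1)]
  obtain B where B: "\<And>r. diff_lift r B" "\<And>x. -1/50 \<le> x \<Longrightarrow> x \<le> 1/50 \<Longrightarrow> B x = 4 * x + 0"
    "\<And>x. 23/1000 \<le> x \<Longrightarrow> x \<le> 977/1000 \<Longrightarrow> B x = 3/4 * x + 3/40"
    using ex_contracting_lift[of "3/40"] by auto
  obtain B' where B': "\<And>r. diff_lift r B'" "\<And>x. -1/50 \<le> x \<Longrightarrow> x \<le> 1/50 \<Longrightarrow> B' x = 4 * x + 0"
    "\<And>x. 23/1000 \<le> x \<Longrightarrow> x \<le> 977/1000 \<Longrightarrow> B' x = 3/4 * x + 7/40"
    using ex_contracting_lift[of "7/40"] by auto
  obtain A where A: "\<And>r. diff_lift r A"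
    "\<And>x. -395/1000 \<le> x \<Longrightarrow> x \<le> 395/1000 \<Longrightarrow> A x = 1/4 * x + 0"
    using ex_opposite_lift by blast
  \<comment> \<open>Copies of A bring the length to k, and every member still fixes 0.\<close>
  define Gs where "Gs = [B, B', A] @ replicate (k - 3) A"
  have set_Gs: "set Gs = {B, B', A}" by (auto simp: Gs_def)
  have IFS: "IFS r k Gs"
    unfolding IFS_def set_Gs using assms(2) A(1) B(1) B'(1) by (auto simp: Gs_def)
  have lifts: "lift1 G \<and> G 0 = 0" if "G \<in> set Gs" for G
    using that lift[OF A(1)] lift[OF B(1)] lift[OF B'(1)] A(2)[of 0] B(2)[of 0] B'(2)[of 0]
    by (auto simp: set_Gs)
  have "RT r k Gs"
  proof (rule RT_if_near_transitive[OF assms(1) IFS, of "1/2000"])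
    fix Hs assume Hs: "\<forall>G\<in>set Hs. lift1 G" "\<forall>G\<in>set Gs. \<exists>g. near Hs (1/2000) G g"
    then obtain b b' a where "near Hs (1/2000) B b" "near Hs (1/2000) B' b'" "near Hs (1/2000) A a"
      unfolding set_Gs by blast
    then show "ifs_transitive Hs"
      by (intro transitive_near_common_fixed_point[OF Hs(1) B(2,3) B'(3) A(2) lift[OF A(1)]])
  qed simp
  moreover have "\<not> ifs_minimal Gs" by (rule not_minimal_fixed_point) (rule lifts)
  moreover have "\<not> ifs_minimal (inv_fam Gs)"
  proof (rule not_minimal_fixed_point)
    fix G assume "G \<in> set (inv_fam Gs)"
    then obtain H where H: "H \<in> set Gs" "G = inv H" by (auto simp: inv_fam_def)
    then show "lift1 G \<and> G 0 = 0" using lifts[OF H(1)] lift1_inv lift1_inv_f by metis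
  qed
  ultimately show "\<exists>Gs. RT r k Gs \<and> \<not> ifs_minimal Gs \<and> \<not> ifs_minimal (inv_fam Gs)" by blast
qed

end
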